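(* Let $-\infty<a<b<\infty$, let $p>1$ and $\alpha\in\left(\frac1p,1\right]$. Let $u\in AC[a,b]$ satisfy $u\in L^p(a,b)$, $u(a)=0$ and $\partial^{\alpha}_{a+}u\in L^p(a,b)$, where $\partial^\alpha_{a+}$ is the left Caputo fractional derivative of order $\alpha$. Then $$\|u\|_{L^{\infty}(a,b)}\leq \frac{(b-a)^{\alpha-\frac{1}{p}}}{\left(\frac{\alpha p}{p-1}-\frac{1}{p-1}\right)^{\frac{p-1}{p}}\Gamma(\alpha)} \left\|\partial^{\alpha}_{a+}u\right\|_{L^p(a,b)}.$$
   Context: $AC[a,b]$ is the space of (real- or complex-valued) absolutely continuous functions on $[a,b]$, and $\Gamma$ is the Euler gamma function. For $\alpha>0$ the left Riemann--Liouville integral is $I_{a+}^\alpha f(t)=\frac{1}{\Gamma(\alpha)}\int_a^t (t-s)^{\alpha-1}f(s)\,ds$, $t\in(a,b]$, and $I_{a+}^0 f=f$. For $0<\alpha\le 1$ and $f\in AC[a,b]$ the left Caputo fractional derivative is $\partial_{a+}^\alpha f(t)=I_{a+}^{1-\alpha}f'(t)$ (defined for almost every $t$); in particular $\partial_{a+}^1 f=f'$. *)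

theory Defs
  imports "HOL-Analysis.Analysis" "HOL-Probability.Essential_Supremum"
begin

(* Degenerate intervals (c = d) are admitted in I; they contribute nothing to either sum. *)
definition absolutely_continuous_on_interval :: "real \<Rightarrow> real \<Rightarrow> (real \<Rightarrow> 'a::real_normed_vector) \<Rightarrow> bool"
  where "absolutely_continuous_on_interval a b f \<longleftrightarrow>
    (\<forall>\<epsilon>>0. \<exists>\<delta>>0. \<forall>I :: (real \<times> real) set.
       finite I \<longrightarrow>
       (\<forall>(c, d)\<in>I. a \<le> c \<and> c \<le> d \<and> d \<le> b) \<longrightarrow>
       disjoint_family_on (\<lambda>(c, d). {c<..<d}) I \<longrightarrow>
       (\<Sum>(c, d)\<in>I. d - c) < \<delta> \<longrightarrow>
       (\<Sum>(c, d)\<in>I. norm (f d - f c)) < \<epsilon>)"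

definition Lp_space :: "real \<Rightarrow> 'b measure \<Rightarrow> ('b \<Rightarrow> 'a::real_normed_vector) set"
  where "Lp_space p M = {f. f \<in> borel_measurable M \<and> integrable M (\<lambda>x. norm (f x) powr p)}"

definition Lp_norm :: "real \<Rightarrow> 'b measure \<Rightarrow> ('b \<Rightarrow> 'a::real_normed_vector) \<Rightarrow> real"
  where "Lp_norm p M f = (LINT x|M. norm (f x) powr p) powr (1 / p)"

(* The extended-real value is \<infinity> if f is not essentially bounded. *)
definition Linf_norm :: "'b measure \<Rightarrow> ('b \<Rightarrow> 'a::real_normed_vector) \<Rightarrow> ereal"
  where "Linf_norm M f = esssup M (\<lambda>x. ereal (norm (f x)))"

(* Meaningful for \<alpha> \<ge> 0. Where the integrand is not Lebesgue integrable the value is 0;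
   for f integrable on [a,b] and \<alpha> > 0 such t form a null subset of [a,b]. *)
definition rl_integral ::
    "real \<Rightarrow> real \<Rightarrow> (real \<Rightarrow> 'a::{banach, second_countable_topology}) \<Rightarrow> real \<Rightarrow> 'a"
  where "rl_integral a \<alpha> f t =
    (if \<alpha> = 0 then f t
     else (1 / Gamma \<alpha>) *\<^sub>R
       set_lebesgue_integral lebesgue {a..t} (\<lambda>s. (t - s) powr (\<alpha> - 1) *\<^sub>R f s))"

(* Meaningful for 0 < \<alpha> \<le> 1 and f absolutely continuous; f' exists only almost everywhere, and
   vector_derivative takes an arbitrary value on the exceptional null set. *)
definition caputo_derivative ::
    "real \<Rightarrow> real \<Rightarrow> (real \<Rightarrow> 'a::{banach, second_countable_topology}) \<Rightarrow> real \<Rightarrow> 'a"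
  where "caputo_derivative a \<alpha> f = rl_integral a (1 - \<alpha>) (\<lambda>s. vector_derivative f (at s))"

(* The scalar fields \<real> and \<complex> are both instances of the sort {real_normed_field, euclidean_space},
   which serves to treat real- and complex-valued functions uniformly. *)

end

theory Submission
  imports Defs
begin

text \<open>
  Since the Beta kernel gives \<open>I\<^sup>\<alpha> I\<^sup>1\<^sup>-\<^sup>\<alpha> = I\<^sup>1\<close>, an absolutely continuous \<open>u\<close> with \<open>u a = 0\<close> is the
  fractional integral of order \<open>\<alpha>\<close> of its Caputo derivative, and Hoelder's inequality applied to the
  kernel \<open>(t - s) powr (\<alpha> - 1)\<close> bounds \<open>u t\<close> pointwise.

  The identity \<open>u t = \<integral> u'\<close> for absolutely continuous \<open>u\<close> rests on Lebesgue's differentiation theorem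
  for functions of bounded variation. If \<open>u\<close> has difference quotients both above \<open>c\<close> and below \<open>-c\<close> at
  arbitrarily small scales around each point of \<open>S\<close>, take a division \<open>D\<close> whose variation is within
  \<open>2 c e\<close> of the supremum; a Vitali family of subintervals on which \<open>u\<close> moves against its net
  increment over the surrounding cell of \<open>D\<close> raises the variation by \<open>2 c\<close> times its total length, so
  \<open>S\<close> has outer measure at most \<open>e\<close>. Given differentiability off a null set, the fundamental theorem is
  a gauge argument: the straddle lemma handles tags where \<open>u\<close> is differentiable, absolute continuity
  handles the tags in the null set.
\<close>

section \<open>Divisions of an interval and the Vitali covering theorem\<close>

text \<open>The increment of \<open>u\<close> is additive when an interval is cut at a point, so it
  is an operative interval function and sums over any division. The auxiliary \<open>g\<close>
  changes it only on the empty set, where additivity forces the value 0 while \<open>Sup\<close> and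
  \<open>Inf\<close> say nothing useful.\<close>

lemma sum_increments_division:
  fixes u :: "real \<Rightarrow> 'a::real_normed_vector"
  assumes D: "D division_of {a..b}" and "a \<le> b"
  shows "(\<Sum>K\<in>D. u (Sup K) - u (Inf K)) = u b - u a"
proof -
  define g where "g K = (if K = {} then 0 else u (Sup K) - u (Inf K))" for K :: "real set"
  interpret operative_real plus 0 g
    rewrites "comm_monoid_set.F (+) 0 = sum"
    by standard[1] (auto simp: g_def sum_def)
  have "(\<Sum>K\<in>D. u (Sup K) - u (Inf K)) = sum g D"
    using division_ofD(3)[OF D] by (intro sum.cong) (auto simp: g_def)
  also have "\<dots> = g {a..b}"
    using D by (simp add: division flip: box_real)
  finally show ?thesis
    using \<open>a \<le> b\<close> by (simp add: g_def)
qed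

lemma division_of_UN:
  assumes D: "D division_of S" and E: "\<And>K. K \<in> D \<Longrightarrow> E K division_of K"
  shows "(\<Union>K\<in>D. E K) division_of S"
proof (rule division_ofI)
  show "finite (\<Union>K\<in>D. E K)"
    using D E by auto
  show "J \<subseteq> S" if "J \<in> (\<Union>K\<in>D. E K)" for J
    using that D E by blast
  show "J \<noteq> {}" "\<exists>a b. J = cbox a b" if "J \<in> (\<Union>K\<in>D. E K)" for J
    using that E by blast+
  show "interior J \<inter> interior J' = {}"
    if J: "J \<in> (\<Union>K\<in>D. E K)" "J' \<in> (\<Union>K\<in>D. E K)" "J \<noteq> J'" for J J'
  proof -
    obtain K K' where K: "K \<in> D" "K' \<in> D" "J \<in> E K" "J' \<in> E K'"
      using J by blast
    show ?thesis
    proof (cases "K = K'")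
      case True
      then show ?thesis
        using division_ofD(5)[OF E[OF K(1)] K(3)] K J(3) by auto
    next
      case False
      have "interior J \<subseteq> interior K" "interior J' \<subseteq> interior K'"
        using division_ofD(2)[OF E[OF K(1)] K(3)] division_ofD(2)[OF E[OF K(2)] K(4)]
        by (simp_all add: interior_mono)
      then show ?thesis
        using division_ofD(5)[OF D K(1,2) False] by blast
    qed
  qed
  show "\<Union>(\<Union>K\<in>D. E K) = S"
  proof -
    have "\<Union>(\<Union>K\<in>D. E K) = (\<Union>K\<in>D. \<Union>(E K))"
      by blast
    also have "\<dots> = S"
      using division_ofD(6)[OF E] division_ofD(6)[OF D] by simp
    finally show ?thesis .
  qed
qed

text \<open>A cell shared by \<open>E K\<close> and \<open>E K'\<close> for distinct
  \<open>K\<close>, \<open>K'\<close> has empty interior, hence is a single point. The double sum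
  may count it repeatedly, which is harmless because \<open>g\<close> vanishes on points.\<close>

lemma sum_division_of_UN:
  fixes g :: "real set \<Rightarrow> 'a::comm_monoid_add"
  assumes D: "D division_of S" and E: "\<And>K. K \<in> D \<Longrightarrow> E K division_of K"
    and g: "\<And>x. g {x} = 0"
  shows "sum g (\<Union>K\<in>D. E K) = (\<Sum>K\<in>D. sum g (E K))"
proof -
  have inj: "inj_on E D"
    using division_ofD(6)[OF E] by (metis inj_onI)
  have "sum g (\<Union>(E ` D)) = (sum \<circ> sum) g (E ` D)"
  proof (rule sum.Union_comp)
    show "\<forall>A\<in>E ` D. finite A"
      using E by auto
    fix A1 A2 J
    assume "A1 \<in> E ` D" "A2 \<in> E ` D" "A1 \<noteq> A2" "J \<in> A1" "J \<in> A2"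
    then obtain K K' where K: "K \<in> D" "K' \<in> D" "K \<noteq> K'" "J \<in> E K" "J \<in> E K'"
      by auto
    have "J \<subseteq> K" "J \<subseteq> K'"
      using division_ofD(2)[OF E] K by blast+
    then have "interior J \<subseteq> interior K \<inter> interior K'"
      by (simp add: interior_mono)
    then have int: "interior J = {}"
      using division_ofD(5)[OF D K(1-3)] by blast
    obtain l r where J: "J = cbox l r"
      using division_ofD(4)[OF E[OF K(1)] K(4)] by blast
    moreover have "J \<noteq> {}"
      using division_ofD(3)[OF E[OF K(1)] K(4)] by blast
    ultimately have "J = {l}"
      using int by (auto simp: interior_cbox)
    then show "g J = 0"
      by (simp add: g)
  qed
  then show ?thesis
    by (simp add: sum.reindex[OF inj])
qed

lemma division_of_disjoint_intervals:
  fixes F :: "(real \<times> real) set"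
  assumes "finite F" and less: "\<And>s t. (s, t) \<in> F \<Longrightarrow> s < t"
    and disj: "pairwise (\<lambda>(s, t) (s', t'). disjnt {s..t} {s'..t'}) F"
  shows "(\<lambda>(s, t). {s..t}) ` F division_of (\<Union>(s, t)\<in>F. {s..t})"
    and "inj_on (\<lambda>(s, t). {s..t}) F"
proof -
  show inj: "inj_on (\<lambda>(s, t). {s..t}) F"
  proof (rule inj_onI)
    fix i j assume "i \<in> F" "j \<in> F" "(\<lambda>(s, t). {s..t}) i = (\<lambda>(s, t). {s..t}) j"
    then show "i = j"
      using less[of "fst i" "snd i"] less[of "fst j" "snd j"]
      by (cases i; cases j) (auto simp: Icc_eq_Icc)
  qed
  show "(\<lambda>(s, t). {s..t}) ` F division_of (\<Union>(s, t)\<in>F. {s..t})"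
  proof (rule division_ofI)
    show "finite ((\<lambda>(s, t). {s..t}) ` F)"
      using \<open>finite F\<close> by simp
    show "J \<subseteq> (\<Union>(s, t)\<in>F. {s..t})" "J \<noteq> {}" "\<exists>a b. J = cbox a b"
      if "J \<in> (\<lambda>(s, t). {s..t}) ` F" for J
      using that less by (fastforce simp: cbox_interval)+
    show "interior J \<inter> interior J' = {}"
      if J: "J \<in> (\<lambda>(s, t). {s..t}) ` F" "J' \<in> (\<lambda>(s, t). {s..t}) ` F" "J \<noteq> J'" for J J'
    proof -
      have "disjnt J J'"
        using J disj by (fastforce simp: pairwise_def)
      then show ?thesis
        using interior_subset by (fastforce simp: disjnt_def)
    qed
  qed auto
qed

section \<open>Outer measure bounds from Vitali coverings\<close>

text \<open>The Vitali covering theorem extracts from \<open>V\<close> a countable disjoint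
  subfamily that covers \<open>S\<close> up to a null set, and the bound on finite disjoint
  subfamilies passes to the countable union. \<open>S\<close> is not known to be measurable, whence
  the conclusion through a measurable superset.\<close>

lemma vitali_outer_bound:
  fixes S :: "real set" and V :: "(real \<times> real) set"
  assumes less: "\<And>s t. (s, t) \<in> V \<Longrightarrow> s < t"
    and cover: "\<And>x d. x \<in> S \<Longrightarrow> 0 < d \<Longrightarrow> \<exists>s t. (s, t) \<in> V \<and> s \<le> x \<and> x \<le> t \<and> t - s < d"
    and bound: "\<And>F. finite F \<Longrightarrow> F \<subseteq> V \<Longrightarrow>
      pairwise (\<lambda>(s, t) (s', t'). disjnt {s..t} {s'..t'}) F \<Longrightarrow> (\<Sum>(s, t)\<in>F. t - s) \<le> e"
  shows "\<exists>T. S \<subseteq> T \<and> T \<in> lmeasurable \<and> measure lebesgue T \<le> e"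
proof -
  \<comment> \<open>The covering theorem speaks of closed balls, so each interval is recoded by its
    midpoint and half its length.\<close>
  define m where "m i = (fst i + snd i) / 2" for i :: "real \<times> real"
  define r where "r i = (snd i - fst i) / 2" for i :: "real \<times> real"
  have ball: "cball (m i) (r i) = (case i of (s, t) \<Rightarrow> {s..t})" for i
    by (cases i) (auto simp: m_def r_def dist_real_def abs_le_iff field_simps)
  have r: "0 < r i" if "i \<in> V" for i
    using less[of "fst i" "snd i"] that by (simp add: r_def)
  have cov: "\<exists>i. i \<in> V \<and> x \<in> cball (m i) (r i) \<and> r i < d" if x: "x \<in> S" "0 < d" for x d
  proof -
    obtain s t where "(s, t) \<in> V" "s \<le> x" "x \<le> t" "t - s < 2 * d"
      using cover[of x "2 * d"] x by auto
    then show ?thesis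
      by (intro exI[of _ "(s, t)"]) (unfold ball, auto simp: r_def)
  qed
  obtain C where C: "countable C" "C \<subseteq> V"
     "pairwise (\<lambda>i j. disjnt (cball (m i) (r i)) (cball (m j) (r j))) C"
     "negligible (S - (\<Union>i\<in>C. cball (m i) (r i)))"
    by (rule Vitali_covering_theorem_cballs[of V r S m, OF r cov])
  have bd: "measure lebesgue (\<Union>i\<in>F. cball (m i) (r i)) \<le> e" if F: "F \<subseteq> C" "finite F" for F
  proof -
    have pw: "pairwise (\<lambda>(s, t) (s', t'). disjnt {s..t} {s'..t'}) F"
    proof (rule pairwiseI)
      fix i j assume "i \<in> F" "j \<in> F" "i \<noteq> j"
      then have "disjnt (cball (m i) (r i)) (cball (m j) (r j))"
        using C(3) F(1) by (auto dest: pairwiseD)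
      then show "(\<lambda>(s, t) (s', t'). disjnt {s..t} {s'..t'}) i j"
        unfolding ball by (cases i; cases j) simp
    qed
    have "measure lebesgue (\<Union>i\<in>F. cball (m i) (r i)) \<le> (\<Sum>i\<in>F. measure lebesgue (cball (m i) (r i)))"
      using F by (intro measure_UNION_le) auto
    also have "\<dots> = (\<Sum>(s, t)\<in>F. t - s)"
      unfolding ball
    proof (intro sum.cong refl, clarify)
      fix s t assume "(s, t) \<in> F"
      then show "measure lebesgue {s..t} = t - s"
        using less[of s t] F C by auto
    qed
    also have "\<dots> \<le> e"
      using bound[OF F(2) _ pw] F(1) C(2) by auto
    finally show ?thesis .
  qed
  have "0 \<le> e"
    using bound[of "{}"] by simp
  have U: "(\<Union>i\<in>C. cball (m i) (r i)) \<in> lmeasurable"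
    "measure lebesgue (\<Union>i\<in>C. cball (m i) (r i)) \<le> e"
    using fmeasurable_UN_bound[of C "\<lambda>i. cball (m i) (r i)" lebesgue e]
      measure_UN_bound[of C "\<lambda>i. cball (m i) (r i)" lebesgue e] C(1) bd \<open>0 \<le> e\<close> by auto
  let ?N = "S - (\<Union>i\<in>C. cball (m i) (r i))"
  show ?thesis
  proof (intro exI conjI)
    show "S \<subseteq> ?N \<union> (\<Union>i\<in>C. cball (m i) (r i))" by blast
    show "?N \<union> (\<Union>i\<in>C. cball (m i) (r i)) \<in> lmeasurable"
      using U C(4) by (intro fmeasurable.Un) (auto simp: negligible_imp_measurable)
    have "measure lebesgue (?N \<union> (\<Union>i\<in>C. cball (m i) (r i)))
        \<le> measure lebesgue ?N + measure lebesgue (\<Union>i\<in>C. cball (m i) (r i))"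
      using U C(4) by (intro measure_Un_le) (auto simp: negligible_imp_sets)
    also have "\<dots> \<le> e"
      using U negligible_imp_measure0[OF C(4)] by simp
    finally show "measure lebesgue (?N \<union> (\<Union>i\<in>C. cball (m i) (r i))) \<le> e" .
  qed
qed

text \<open>Refine each cell \<open>K\<close> of \<open>D\<close> by the disjoint intervals of
  \<open>F\<close> assigned to it. The increments signed by \<open>\<sigma> K\<close> still add up
  to the absolute increment over \<open>K\<close>, whereas on an interval moving against
  \<open>\<sigma> K\<close> the absolute increment exceeds the signed one by at least
  \<open>2 * c\<close> times its length. Near-optimality of \<open>D\<close> leaves room for a gain
  of at most \<open>2 * c * e\<close>.\<close>

lemma oscillation_outer_bound:
  fixes u :: "real \<Rightarrow> real" and S :: "real set"
  assumes "a < b" "0 < c" and S: "S \<subseteq> {a<..<b}"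
    and up: "\<And>x d. x \<in> S \<Longrightarrow> 0 < d \<Longrightarrow>
      \<exists>s t. s \<le> x \<and> x \<le> t \<and> s < t \<and> t - s < d \<and> c * (t - s) \<le> u t - u s"
    and down: "\<And>x d. x \<in> S \<Longrightarrow> 0 < d \<Longrightarrow>
      \<exists>s t. s \<le> x \<and> x \<le> t \<and> s < t \<and> t - s < d \<and> u t - u s \<le> - c * (t - s)"
    and D: "D division_of {a..b}"
    and near_opt: "\<And>E. E division_of {a..b} \<Longrightarrow>
      (\<Sum>K\<in>E. \<bar>u (Sup K) - u (Inf K)\<bar>) \<le> (\<Sum>K\<in>D. \<bar>u (Sup K) - u (Inf K)\<bar>) + 2 * c * e"
  shows "\<exists>T. S \<subseteq> T \<and> T \<in> lmeasurable \<and> measure lebesgue T \<le> e"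
proof -
  define \<nu> where "\<nu> K = u (Sup K) - u (Inf K)" for K
  define \<sigma> :: "real set \<Rightarrow> real" where "\<sigma> K = (if 0 \<le> \<nu> K then 1 else - 1)" for K
  \<comment> \<open>A point of \<open>S\<close> outside this finite set of endpoints is interior to
    its cell, so short intervals around it stay in the cell. The endpoints return at the end as a
    null set.\<close>
  define P where "P = Inf ` D \<union> Sup ` D"
  define V where "V = {(s, t). s < t \<and> (\<exists>K\<in>D. {s..t} \<subseteq> K \<and> \<sigma> K * (u t - u s) \<le> - c * (t - s))}"
  have D_Icc: "\<exists>l r. K = {l..r} \<and> l \<le> r" if "K \<in> D" for K
    using division_ofD(3,4)[OF D that] by (auto simp: cbox_interval)
  have "finite P"
    using D by (auto simp: P_def)
  have "\<exists>T. S - P \<subseteq> T \<and> T \<in> lmeasurable \<and> measure lebesgue T \<le> e"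
  proof (rule vitali_outer_bound[of V])
    show "s < t" if "(s, t) \<in> V" for s t
      using that by (simp add: V_def)
    show "\<exists>s t. (s, t) \<in> V \<and> s \<le> x \<and> x \<le> t \<and> t - s < d" if x: "x \<in> S - P" and "0 < d" for x d
    proof -
      have "x \<in> \<Union>D"
        using division_ofD(6)[OF D] x S by auto
      then obtain K where K: "K \<in> D" "x \<in> K"
        by blast
      obtain l r where lr: "K = {l..r}" "l \<le> r"
        using D_Icc[OF K(1)] by blast
      then have "l \<in> P" "r \<in> P"
        using K by (auto simp: P_def intro!: rev_image_eqI[of K])
      then have lxr: "l < x" "x < r"
        using x K lr by (auto simp: order.order_iff_strict)
      define d' where "d' = min d (min (x - l) (r - x))"
      have d': "0 < d'" "d' \<le> d" "d' \<le> x - l" "d' \<le> r - x"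
        using lxr \<open>0 < d\<close> by (auto simp: d'_def)
      \<comment> \<open>The sign of the net increment over \<open>K\<close> selects the hypothesis:
        \<open>down\<close> if it is nonnegative, \<open>up\<close> otherwise.\<close>
      obtain s t where st: "s \<le> x" "x \<le> t" "s < t" "t - s < d'" "\<sigma> K * (u t - u s) \<le> - c * (t - s)"
      proof (cases "0 \<le> \<nu> K")
        case True
        with down[of x d'] d' x that show ?thesis by (auto simp: \<sigma>_def)
      next
        case False
        with up[of x d'] d' x that show ?thesis by (auto simp: \<sigma>_def)
      qed
      then have "(s, t) \<in> V"
        using d' K lr by (auto simp: V_def intro!: bexI[of _ K])
      then show ?thesis
        using st d' by (intro exI[of _ s] exI[of _ t]) auto
    qed
    fix F assume F: "finite F" "F \<subseteq> V"
      and disj: "pairwise (\<lambda>(s, t) (s', t'). disjnt {s..t} {s'..t'}) F"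
    \<comment> \<open>Fixing one cell for each interval splits \<open>F\<close> into the classes
      \<open>G K\<close>, so that every length is counted exactly once when the gains are added over
      \<open>D\<close>.\<close>
    define \<kappa> where "\<kappa> i = (SOME K. K \<in> D \<and> {fst i..snd i} \<subseteq> K \<and>
        \<sigma> K * (u (snd i) - u (fst i)) \<le> - c * (snd i - fst i))" for i
    have \<kappa>: "\<kappa> i \<in> D \<and> {fst i..snd i} \<subseteq> \<kappa> i \<and>
        \<sigma> (\<kappa> i) * (u (snd i) - u (fst i)) \<le> - c * (snd i - fst i)" if "i \<in> F" for i
      unfolding \<kappa>_def by (rule someI_ex) (use that F in \<open>force simp: V_def\<close>)
    have less: "fst i < snd i" if "i \<in> F" for i
      using that F by (force simp: V_def)
    define J where "J = (\<lambda>(s, t). {s..t} :: real set)"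
    define G where "G K = {i \<in> F. \<kappa> i = K}" for K
    have "\<exists>E. J ` G K \<subseteq> E \<and> E division_of K" if K: "K \<in> D" for K
    proof -
      have G: "finite (G K)" "G K \<subseteq> F"
        using F by (auto simp: G_def)
      have div: "J ` G K division_of (\<Union>(s, t)\<in>G K. {s..t})"
        unfolding J_def
        by (rule division_of_disjoint_intervals) (use G less disj in \<open>auto intro: pairwise_subset\<close>)
      moreover have "(\<Union>(s, t)\<in>G K. {s..t}) \<subseteq> K"
        using \<kappa> by (fastforce simp: G_def)
      moreover obtain l r where "K = cbox l r"
        using division_ofD(4)[OF D K] by blast
      moreover have "\<Union>(J ` G K) = (\<Union>(s, t)\<in>G K. {s..t})"
        by (simp add: J_def)
      ultimately show ?thesis
        using partial_division_extend_interval[of "J ` G K" l r] by metis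
    qed
    then obtain E where E: "\<And>K. K \<in> D \<Longrightarrow> J ` G K \<subseteq> E K" "\<And>K. K \<in> D \<Longrightarrow> E K division_of K"
      by metis
    have gain: "\<bar>\<nu> K\<bar> + 2 * c * (\<Sum>(s, t)\<in>G K. t - s) \<le> (\<Sum>I\<in>E K. \<bar>\<nu> I\<bar>)" if K: "K \<in> D" for K
    proof -
      obtain l r where lr: "K = {l..r}" "l \<le> r"
        using D_Icc[OF K] by blast
      have fin: "finite (E K)"
        using E(2)[OF K] by auto
      have inj: "inj_on J (G K)"
        unfolding J_def
        by (rule division_of_disjoint_intervals(2))
          (use F less disj in \<open>auto simp: G_def intro: pairwise_subset\<close>)
      have "(\<Sum>I\<in>E K. \<sigma> K * \<nu> I) = \<sigma> K * \<nu> K"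
        using sum_increments_division[of "E K" l r u] E(2)[OF K] lr
        by (simp add: \<nu>_def flip: sum_distrib_left)
      then have eq1: "\<bar>\<nu> K\<bar> = (\<Sum>I\<in>E K. \<sigma> K * \<nu> I)"
        by (simp add: \<sigma>_def)
      have "2 * c * (\<Sum>(s, t)\<in>G K. t - s) = (\<Sum>i\<in>G K. 2 * c * (Sup (J i) - Inf (J i)))"
        unfolding sum_distrib_left
        by (intro sum.cong refl) (use less in \<open>force simp: J_def G_def\<close>)
      also have "\<dots> = (\<Sum>I\<in>J ` G K. 2 * c * (Sup I - Inf I))"
        by (simp add: sum.reindex[OF inj])
      also have "\<dots> = (\<Sum>I\<in>E K. if I \<in> J ` G K then 2 * c * (Sup I - Inf I) else 0)"
        using E(1)[OF K] fin by (simp add: sum.inter_restrict[symmetric] Int_absorb1 Int_commute)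
      finally have eq2: "2 * c * (\<Sum>(s, t)\<in>G K. t - s)
          = (\<Sum>I\<in>E K. if I \<in> J ` G K then 2 * c * (Sup I - Inf I) else 0)" .
      have "\<sigma> K * \<nu> I + (if I \<in> J ` G K then 2 * c * (Sup I - Inf I) else 0) \<le> \<bar>\<nu> I\<bar>" for I
      proof (cases "I \<in> J ` G K")
        case True
        then obtain s t where st: "(s, t) \<in> G K" "I = {s..t}"
          by (auto simp: J_def)
        have *: "s < t" "\<sigma> K * (u t - u s) \<le> - c * (t - s)"
          using \<kappa>[of "(s, t)"] less[of "(s, t)"] st by (auto simp: G_def)
        have "- (\<sigma> K * (u t - u s)) \<le> \<bar>u t - u s\<bar>"
          by (auto simp: \<sigma>_def)
        moreover have "Sup I = t" "Inf I = s"
          using st * by auto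
        ultimately show ?thesis
          using True * by (simp add: \<nu>_def)
      next
        case False
        then show ?thesis by (auto simp: \<sigma>_def)
      qed
      then show ?thesis
        unfolding eq1 eq2 sum.distrib[symmetric] by (intro sum_mono)
    qed
    have "(\<Sum>K\<in>D. \<bar>\<nu> K\<bar>) + 2 * c * (\<Sum>(s, t)\<in>F. t - s)
        = (\<Sum>K\<in>D. \<bar>\<nu> K\<bar> + 2 * c * (\<Sum>(s, t)\<in>G K. t - s))"
      unfolding sum.distrib sum_distrib_left[symmetric] G_def
      by (subst sum.group) (use F D \<kappa> in auto)
    also have "\<dots> \<le> (\<Sum>K\<in>D. \<Sum>I\<in>E K. \<bar>\<nu> I\<bar>)"
      by (intro sum_mono gain)
    also have "\<dots> = (\<Sum>I\<in>(\<Union>K\<in>D. E K). \<bar>\<nu> I\<bar>)"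
      by (rule sum_division_of_UN[OF D E(2), symmetric]) (auto simp: \<nu>_def)
    also have "\<dots> \<le> (\<Sum>K\<in>D. \<bar>\<nu> K\<bar>) + 2 * c * e"
      unfolding \<nu>_def by (intro near_opt division_of_UN[OF D E(2)])
    finally show "(\<Sum>(s, t)\<in>F. t - s) \<le> e"
      using \<open>0 < c\<close> by simp
  qed
  then obtain T where T: "S - P \<subseteq> T" "T \<in> lmeasurable" "measure lebesgue T \<le> e"
    by blast
  have P: "negligible P"
    using \<open>finite P\<close> by (rule negligible_finite)
  show ?thesis
  proof (intro exI conjI)
    show "S \<subseteq> P \<union> T" using T by blast
    show "P \<union> T \<in> lmeasurable"
      using T P by (intro fmeasurable.Un) (auto simp: negligible_imp_measurable)
    have "measure lebesgue (P \<union> T) \<le> measure lebesgue P + measure lebesgue T"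
      using T P by (intro measure_Un_le) (auto simp: negligible_imp_sets)
    then show "measure lebesgue (P \<union> T) \<le> e"
      using T negligible_imp_measure0[OF P] by simp
  qed
qed

text \<open>Bounded variation makes the supremum of the variation sums finite, so for every
  \<open>e\<close> some division comes within \<open>2 * c * e\<close> of it, and
  \<open>oscillation_outer_bound\<close> applies.\<close>

lemma negligible_oscillation:
  fixes u :: "real \<Rightarrow> real" and S :: "real set"
  assumes "a < b" "0 < c" and S: "S \<subseteq> {a<..<b}"
    and up: "\<And>x d. x \<in> S \<Longrightarrow> 0 < d \<Longrightarrow>
      \<exists>s t. s \<le> x \<and> x \<le> t \<and> s < t \<and> t - s < d \<and> c * (t - s) \<le> u t - u s"
    and down: "\<And>x d. x \<in> S \<Longrightarrow> 0 < d \<Longrightarrow>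
      \<exists>s t. s \<le> x \<and> x \<le> t \<and> s < t \<and> t - s < d \<and> u t - u s \<le> - c * (t - s)"
    and bv: "\<And>D. D division_of {a..b} \<Longrightarrow> (\<Sum>K\<in>D. \<bar>u (Sup K) - u (Inf K)\<bar>) \<le> B"
  shows "negligible S"
  unfolding negligible_outer_le
proof (intro allI impI)
  fix e :: real assume "0 < e"
  let ?V = "\<lambda>D. \<Sum>K\<in>D. \<bar>u (Sup K) - u (Inf K)\<bar>"
  let ?A = "?V ` {D. D division_of {a..b}}"
  have "{{a..b}} division_of {a..b}"
    using division_of_self[of a b] \<open>a < b\<close> by (simp add: cbox_interval)
  then have ne: "?A \<noteq> {}"
    by blast
  have bdd: "bdd_above ?A"
    using bv by (auto intro!: bdd_aboveI[of _ B])
  have "Sup ?A - 2 * c * e < Sup ?A"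
    using \<open>0 < c\<close> \<open>0 < e\<close> by simp
  then obtain D where D: "D division_of {a..b}" "Sup ?A - 2 * c * e < ?V D"
    unfolding less_cSup_iff[OF ne bdd] by blast
  show "\<exists>T. S \<subseteq> T \<and> T \<in> lmeasurable \<and> measure lebesgue T \<le> e"
  proof (rule oscillation_outer_bound[OF \<open>a < b\<close> \<open>0 < c\<close> S up down D(1)])
    fix E assume "E division_of {a..b}"
    then have "?V E \<le> Sup ?A"
      using bdd by (intro cSup_upper) auto
    then show "?V E \<le> ?V D + 2 * c * e"
      using D(2) by linarith
  qed
qed

text \<open>Disjoint intervals on which the mean slope is at least \<open>M\<close> in absolute
  value have total length at most \<open>B / M\<close>, and \<open>M\<close> may be taken
  arbitrarily large.\<close>

lemma negligible_steep:
  fixes u :: "real \<Rightarrow> real" and S :: "real set"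
  assumes S: "S \<subseteq> {a<..<b}"
    and steep: "\<And>x d M. x \<in> S \<Longrightarrow> 0 < d \<Longrightarrow>
      \<exists>s t. s \<le> x \<and> x \<le> t \<and> s < t \<and> t - s < d \<and> M * (t - s) \<le> \<bar>u t - u s\<bar>"
    and bv: "\<And>D. D division_of {a..b} \<Longrightarrow> (\<Sum>K\<in>D. \<bar>u (Sup K) - u (Inf K)\<bar>) \<le> B"
  shows "negligible S"
  unfolding negligible_outer_le
proof (intro allI impI)
  fix e :: real assume "0 < e"
  \<comment> \<open>This choice gives \<open>B \<le> M * e\<close>; the summand 1 keeps
    \<open>M\<close> positive even for \<open>B = 0\<close>.\<close>
  define M where "M = (\<bar>B\<bar> + 1) / e"
  have "0 < M"
    using \<open>0 < e\<close> by (simp add: M_def)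
  define V where "V = {(s, t). s < t \<and> {s..t} \<subseteq> {a..b} \<and> M * (t - s) \<le> \<bar>u t - u s\<bar>}"
  show "\<exists>T. S \<subseteq> T \<and> T \<in> lmeasurable \<and> measure lebesgue T \<le> e"
  proof (rule vitali_outer_bound[of V])
    show "s < t" if "(s, t) \<in> V" for s t
      using that by (simp add: V_def)
    show "\<exists>s t. (s, t) \<in> V \<and> s \<le> x \<and> x \<le> t \<and> t - s < d" if x: "x \<in> S" and "0 < d" for x d
    proof -
      have "0 < min d (min (x - a) (b - x))"
        using x S \<open>0 < d\<close> by auto
      from steep[OF x this, of M] obtain s t where
        "s \<le> x" "x \<le> t" "s < t" "t - s < min d (min (x - a) (b - x))" "M * (t - s) \<le> \<bar>u t - u s\<bar>"
        by blast
      then show ?thesis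
        by (intro exI[of _ s] exI[of _ t]) (auto simp: V_def)
    qed
    fix F assume F: "finite F" "F \<subseteq> V"
      and disj: "pairwise (\<lambda>(s, t) (s', t'). disjnt {s..t} {s'..t'}) F"
    define J where "J = (\<lambda>(s, t). {s..t} :: real set)"
    have less: "s < t" if "(s, t) \<in> F" for s t
      using that F by (auto simp: V_def)
    note J = division_of_disjoint_intervals[OF F(1) less disj, folded J_def]
    have "\<Union>(J ` F) \<subseteq> cbox a b"
      using F by (force simp: J_def V_def)
    moreover have "J ` F division_of \<Union>(J ` F)"
      using J(1) by (simp add: J_def)
    ultimately obtain E where E: "J ` F \<subseteq> E" "E division_of cbox a b"
      using partial_division_extend_interval[of "J ` F" a b] by metis
    have "M * (\<Sum>(s, t)\<in>F. t - s) = (\<Sum>(s, t)\<in>F. M * (t - s))"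
      by (simp add: sum_distrib_left case_prod_beta)
    also have "\<dots> \<le> (\<Sum>i\<in>F. \<bar>u (Sup (J i)) - u (Inf (J i))\<bar>)"
      using F by (intro sum_mono) (force simp: J_def V_def)
    also have "\<dots> = (\<Sum>K\<in>J ` F. \<bar>u (Sup K) - u (Inf K)\<bar>)"
      by (simp add: sum.reindex[OF J(2)])
    also have "\<dots> \<le> (\<Sum>K\<in>E. \<bar>u (Sup K) - u (Inf K)\<bar>)"
      using E by (intro sum_mono2) auto
    also have "\<dots> \<le> M * e"
      using bv[of E] E \<open>0 < e\<close> by (simp add: M_def cbox_interval)
    finally show "(\<Sum>(s, t)\<in>F. t - s) \<le> e"
      using \<open>0 < M\<close> by simp
  qed
qed

section \<open>Almost everywhere differentiability\<close>

text \<open>The difference quotient is symmetric in its two points, so a nearby \<open>y\<close> on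
  either side of \<open>x\<close> yields an interval with endpoint \<open>x\<close>. The predicate
  \<open>R\<close> stays general to serve large absolute slopes as well as upper and lower
  thresholds.\<close>

lemma frequently_quotient_interval:
  fixes u :: "real \<Rightarrow> real"
  assumes "frequently (\<lambda>y. R ((u y - u x) / (y - x))) (at x)" and "0 < d"
  shows "\<exists>s t. s \<le> x \<and> x \<le> t \<and> s < t \<and> t - s < d \<and> R ((u t - u s) / (t - s))"
proof -
  obtain y where y: "y \<noteq> x" "dist y x < d" "R ((u y - u x) / (y - x))"
    using assms unfolding frequently_at by auto
  show ?thesis
  proof (cases "x < y")
    case True
    then show ?thesis
      using y by (intro exI[of _ x] exI[of _ y]) (auto simp: dist_real_def)
  next
    case False
    moreover have "(u y - u x) / (y - x) = (u x - u y) / (x - y)"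
      by (metis minus_diff_eq minus_divide_divide)
    ultimately show ?thesis
      using y by (intro exI[of _ y] exI[of _ x]) (auto simp: dist_real_def)
  qed
qed

text \<open>Where the derivative fails to exist, either the difference quotients are unbounded near
  the point, which is the set \<open>W\<close>, or their lower and upper limits are finite and
  distinct. In the latter case two rationals fit between the limits and the point lies in one of
  countably many sets \<open>S p q\<close>.\<close>

lemma negligible_not_differentiable_bv:
  fixes u :: "real \<Rightarrow> real"
  assumes "a < b" and bv: "\<And>D. D division_of {a..b} \<Longrightarrow> (\<Sum>K\<in>D. \<bar>u (Sup K) - u (Inf K)\<bar>) \<le> B"
  shows "negligible {x\<in>{a<..<b}. \<not> u differentiable at x}"
proof -
  define Q where "Q x y = (u y - u x) / (y - x)" for x y
  define S where "S p q = {x\<in>{a<..<b}. frequently (\<lambda>y. Q x y \<le> p) (at x) \<and> frequently (\<lambda>y. q \<le> Q x y) (at x)}"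
    for p q
  define W where "W = {x\<in>{a<..<b}. \<forall>M. frequently (\<lambda>y. M \<le> \<bar>Q x y\<bar>) (at x)}"
  have "negligible W"
  proof (rule negligible_steep[OF _ _ bv])
    show "W \<subseteq> {a<..<b}"
      by (auto simp: W_def)
    fix x d M :: real assume "x \<in> W" "0 < d"
    then show "\<exists>s t. s \<le> x \<and> x \<le> t \<and> s < t \<and> t - s < d \<and> M * (t - s) \<le> \<bar>u t - u s\<bar>"
      using frequently_quotient_interval[of "\<lambda>z. M \<le> \<bar>z\<bar>" u x d]
      by (fastforce simp: W_def Q_def field_simps)
  qed
  moreover have "negligible (S p q)" if "p < q" for p q
  proof -
    define c where "c = (q - p) / 2"
    define m where "m = (p + q) / 2"
    have "0 < c" and c: "p = m - c" "q = m + c"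
      using that by (auto simp: c_def m_def field_simps)
    \<comment> \<open>Subtracting a line of slope \<open>m\<close> turns the thresholds
      \<open>p\<close> and \<open>q\<close> into \<open>- c\<close> and \<open>c\<close>, and raises
      the variation by at most \<open>\<bar>m\<bar> * (b - a)\<close>.\<close>
    define v where "v x = u x - m * x" for x
    show ?thesis
    proof (rule negligible_oscillation[OF \<open>a < b\<close> \<open>0 < c\<close>])
      show "S p q \<subseteq> {a<..<b}"
        by (auto simp: S_def)
      fix x d :: real assume x: "x \<in> S p q" "0 < d"
      then show "\<exists>s t. s \<le> x \<and> x \<le> t \<and> s < t \<and> t - s < d \<and> c * (t - s) \<le> v t - v s"
        using frequently_quotient_interval[of "\<lambda>z. q \<le> z" u x d]
        by (fastforce simp: S_def Q_def c v_def field_simps)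
      show "\<exists>s t. s \<le> x \<and> x \<le> t \<and> s < t \<and> t - s < d \<and> v t - v s \<le> - c * (t - s)"
        using frequently_quotient_interval[of "\<lambda>z. z \<le> p" u x d] x
        by (fastforce simp: S_def Q_def c v_def field_simps)
    next
      fix D assume D: "D division_of {a..b}"
      have "(\<Sum>K\<in>D. \<bar>v (Sup K) - v (Inf K)\<bar>)
          \<le> (\<Sum>K\<in>D. \<bar>u (Sup K) - u (Inf K)\<bar> + \<bar>m\<bar> * (Sup K - Inf K))"
      proof (intro sum_mono)
        fix K assume "K \<in> D"
        then obtain l r where "K = {l..r}" "l \<le> r"
          using division_ofD(3,4)[OF D] by (force simp: cbox_interval)
        then have "\<bar>m\<bar> * (Sup K - Inf K) = \<bar>m * (Sup K - Inf K)\<bar>"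
          by (simp add: abs_mult)
        then show "\<bar>v (Sup K) - v (Inf K)\<bar> \<le> \<bar>u (Sup K) - u (Inf K)\<bar> + \<bar>m\<bar> * (Sup K - Inf K)"
          by (simp add: v_def algebra_simps)
      qed
      also have "\<dots> \<le> B + \<bar>m\<bar> * (b - a)"
        using bv[OF D] sum_increments_division[OF D, of "\<lambda>x. x"] \<open>a < b\<close>
        by (simp add: sum.distrib flip: sum_distrib_left)
      finally show "(\<Sum>K\<in>D. \<bar>v (Sup K) - v (Inf K)\<bar>) \<le> B + \<bar>m\<bar> * (b - a)" .
    qed
  qed
  moreover have "{x\<in>{a<..<b}. \<not> u differentiable at x}
      \<subseteq> W \<union> (\<Union>(p, q)\<in>{(p, q). p \<in> \<rat> \<and> q \<in> \<rat> \<and> p < q}. S p q)"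
  proof clarify
    fix x assume x: "x \<in> {a<..<b}" and nd: "\<not> u differentiable at x"
      and nU: "x \<notin> (\<Union>(p, q)\<in>{(p, q). p \<in> \<rat> \<and> q \<in> \<rat> \<and> p < q}. S p q)"
    show "x \<in> W"
    proof (rule ccontr)
      assume "x \<notin> W"
      then obtain M where M: "eventually (\<lambda>y. \<bar>Q x y\<bar> < M) (at x)"
        using x by (auto simp: W_def frequently_def not_le)
      define L where "L = Liminf (at x) (\<lambda>y. ereal (Q x y))"
      define U where "U = Limsup (at x) (\<lambda>y. ereal (Q x y))"
      have "ereal (- M) \<le> L"
        unfolding L_def using M by (intro Liminf_bounded) (auto elim!: eventually_mono)
      moreover have "U \<le> ereal M"
        unfolding U_def using M by (intro Limsup_bounded) (auto elim!: eventually_mono)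
      moreover have "L \<le> U"
        unfolding L_def U_def by (intro Liminf_le_Limsup) simp
      moreover have "\<not> L < U"
      proof
        assume "L < U"
        \<comment> \<open>The reals chosen here only locate rationals with
          \<open>L < p' < q < q' < U\<close>; rationality keeps the family of sets \<open>S\<close>
          countable.\<close>
        then obtain q where q: "L < ereal q" "ereal q < U"
          using ereal_dense2 by blast
        then obtain p where p: "L < ereal p" "ereal p < ereal q"
          using ereal_dense2 by blast
        obtain p' where p': "p' \<in> \<rat>" "p < p'" "p' < q"
          using Rats_dense_in_real[of p q] p by auto
        have "L < ereal p'"
          using p(1) p'(2) by (meson less_ereal.simps(1) order.strict_trans)
        obtain q'' where q'': "ereal q < ereal q''" "ereal q'' < U"
          using ereal_dense2[OF q(2)] by blast
        obtain q' where q': "q' \<in> \<rat>" "q < q'" "q' < q''"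
          using Rats_dense_in_real[of q q''] q'' by auto
        have "ereal q' < U"
          using q''(2) q'(3) by (meson less_ereal.simps(1) order.strict_trans)
        have "frequently (\<lambda>y. Q x y \<le> p') (at x)"
        proof (rule ccontr)
          assume "\<not> ?thesis"
          then have "eventually (\<lambda>y. ereal p' \<le> ereal (Q x y)) (at x)"
            by (auto simp: frequently_def elim!: eventually_mono)
          then have "ereal p' \<le> L"
            unfolding L_def by (rule Liminf_bounded)
          then show False
            using \<open>L < ereal p'\<close> by simp
        qed
        moreover have "frequently (\<lambda>y. q' \<le> Q x y) (at x)"
        proof (rule ccontr)
          assume "\<not> ?thesis"
          then have "eventually (\<lambda>y. ereal (Q x y) \<le> ereal q') (at x)"
            by (auto simp: frequently_def elim!: eventually_mono)
          then have "U \<le> ereal q'"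
            unfolding U_def by (rule Limsup_bounded)
          then show False
            using \<open>ereal q' < U\<close> by simp
        qed
        ultimately have "x \<in> S p' q'"
          using x by (simp add: S_def)
        then show False
          using nU p' q' by auto
      qed
      ultimately obtain l where l: "L = ereal l" "U = ereal l"
        by (cases L; cases U) auto
      have "((\<lambda>y. ereal (Q x y)) \<longlongrightarrow> ereal l) (at x)"
        using l by (subst tendsto_iff_Liminf_eq_Limsup) (auto simp: L_def U_def)
      then have "((\<lambda>y. (u y - u x) / (y - x)) \<longlongrightarrow> l) (at x)"
        by (simp add: Q_def)
      then have "(u has_field_derivative l) (at x)"
        by (simp add: has_field_derivative_iff)
      then show False
        using nd real_differentiable_def by blast
    qed
  qed
  moreover have "countable {(p, q). p \<in> \<rat> \<and> q \<in> (\<rat>::real set) \<and> p < q}"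
    by (rule countable_subset[of _ "\<rat> \<times> \<rat>"]) (auto intro: countable_rat)
  ultimately show ?thesis
    by (elim negligible_subset[rotated])
      (intro negligible_Un negligible_countable_Union countable_image; auto)
qed

section \<open>Absolute continuity in terms of divisions\<close>

text \<open>A nonempty compact interval is determined by its endpoints, and cells with disjoint
  interiors give disjoint open intervals, so a division is an admissible family of pairs. The gauge
  and variation arguments below work with divisions.\<close>

lemma absolutely_continuous_on_intervalD:
  assumes "absolutely_continuous_on_interval a b u" and "0 < e"
  shows "\<exists>d>0. \<forall>D. D division_of \<Union>D \<longrightarrow> \<Union>D \<subseteq> {a..b} \<longrightarrow> (\<Sum>K\<in>D. Sup K - Inf K) < d \<longrightarrow>
    (\<Sum>K\<in>D. norm (u (Sup K) - u (Inf K))) < e"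
proof -
  obtain d where "0 < d" and d: "\<And>I. finite I \<Longrightarrow>
       (\<forall>(c, d)\<in>I. a \<le> c \<and> c \<le> d \<and> d \<le> b) \<Longrightarrow>
       disjoint_family_on (\<lambda>(c, d). {c<..<d}) I \<Longrightarrow>
       (\<Sum>(c, d)\<in>I. d - c) < d \<Longrightarrow>
       (\<Sum>(c, d)\<in>I. norm (u d - u c)) < e"
    using assms unfolding absolutely_continuous_on_interval_def by meson
  show ?thesis
  proof (intro exI[of _ d] conjI allI impI)
    show "0 < d" by fact
    fix D assume D: "D division_of \<Union>D" "\<Union>D \<subseteq> {a..b}" "(\<Sum>K\<in>D. Sup K - Inf K) < d"
    define g where "g K = (Inf K, Sup K)" for K :: "real set"
    have Icc: "\<exists>l r. K = {l..r} \<and> l \<le> r" if "K \<in> D" for K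
      using division_ofD(3,4)[OF D(1) that] by (auto simp: cbox_interval)
    then have K_eq: "K = {Inf K..Sup K}" "Inf K \<le> Sup K" if "K \<in> D" for K
      using that by force+
    have inj: "inj_on g D"
      using K_eq by (intro inj_onI) (metis g_def prod.inject)
    have "(\<Sum>(c, d)\<in>g ` D. norm (u d - u c)) < e"
    proof (rule d)
      show "finite (g ` D)"
        using D by auto
      show "\<forall>(c, d)\<in>g ` D. a \<le> c \<and> c \<le> d \<and> d \<le> b"
      proof
        fix i assume "i \<in> g ` D"
        then obtain K where "K \<in> D" "i = g K"
          by blast
        moreover from this have "{Inf K..Sup K} \<subseteq> {a..b}" "Inf K \<le> Sup K"
          using K_eq[of K] D(2) by auto
        ultimately show "case i of (c, d) \<Rightarrow> a \<le> c \<and> c \<le> d \<and> d \<le> b"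
          by (auto simp: g_def)
      qed
      show "disjoint_family_on (\<lambda>(c, d). {c<..<d}) (g ` D)"
        unfolding disjoint_family_on_def
      proof (intro ballI impI)
        fix i j assume "i \<in> g ` D" "j \<in> g ` D" "i \<noteq> j"
        then obtain K K' where K: "K \<in> D" "K' \<in> D" "g K \<noteq> g K'" and ij: "i = g K" "j = g K'"
          by blast
        then have "interior {Inf K..Sup K} \<inter> interior {Inf K'..Sup K'} = {}"
          using division_ofD(5)[OF D(1) K(1,2)] K_eq by (metis)
        then show "(case i of (c, d) \<Rightarrow> {c<..<d}) \<inter> (case j of (c, d) \<Rightarrow> {c<..<d}) = {}"
          by (simp add: g_def ij)
      qed
      show "(\<Sum>(c, d)\<in>g ` D. d - c) < d"
        unfolding sum.reindex[OF inj] using D(3) by (simp add: g_def)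
    qed
    then show "(\<Sum>K\<in>D. norm (u (Sup K) - u (Inf K))) < e"
      unfolding sum.reindex[OF inj] by (simp add: g_def)
  qed
qed

section \<open>Absolutely continuous functions\<close>

lemma absolutely_continuous_on_interval_subinterval:
  assumes "absolutely_continuous_on_interval a b u" and "a \<le> c" "d \<le> b"
  shows "absolutely_continuous_on_interval c d u"
  unfolding absolutely_continuous_on_interval_def
proof (intro allI impI)
  fix e :: real assume "0 < e"
  then obtain \<delta> where "0 < \<delta>" and \<delta>: "\<And>I. finite I \<Longrightarrow>
       (\<forall>(c, d)\<in>I. a \<le> c \<and> c \<le> d \<and> d \<le> b) \<Longrightarrow>
       disjoint_family_on (\<lambda>(c, d). {c<..<d}) I \<Longrightarrow>
       (\<Sum>(c, d)\<in>I. d - c) < \<delta> \<Longrightarrow>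
       (\<Sum>(c, d)\<in>I. norm (u d - u c)) < e"
    using assms(1) unfolding absolutely_continuous_on_interval_def by meson
  show "\<exists>\<delta>>0. \<forall>I. finite I \<longrightarrow> (\<forall>(c', d')\<in>I. c \<le> c' \<and> c' \<le> d' \<and> d' \<le> d) \<longrightarrow>
      disjoint_family_on (\<lambda>(c, d). {c<..<d}) I \<longrightarrow> (\<Sum>(c, d)\<in>I. d - c) < \<delta> \<longrightarrow>
      (\<Sum>(c, d)\<in>I. norm (u d - u c)) < e"
  proof (intro exI[of _ \<delta>] conjI allI impI)
    fix I :: "(real \<times> real) set"
    assume I: "finite I" "\<forall>(c', d')\<in>I. c \<le> c' \<and> c' \<le> d' \<and> d' \<le> d"
      "disjoint_family_on (\<lambda>(c, d). {c<..<d}) I" "(\<Sum>(c, d)\<in>I. d - c) < \<delta>"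
    have "\<forall>(c, d)\<in>I. a \<le> c \<and> c \<le> d \<and> d \<le> b"
      using I(2) assms(2,3) by auto
    with I show "(\<Sum>(c, d)\<in>I. norm (u d - u c)) < e"
      by (intro \<delta>)
  qed (rule \<open>0 < \<delta>\<close>)
qed

lemma absolutely_continuous_on_interval_inner:
  fixes u :: "real \<Rightarrow> 'a::euclidean_space"
  assumes "absolutely_continuous_on_interval a b u" and i: "i \<in> Basis"
  shows "absolutely_continuous_on_interval a b (\<lambda>x. u x \<bullet> i)"
  unfolding absolutely_continuous_on_interval_def
proof (intro allI impI)
  fix e :: real assume "0 < e"
  then obtain \<delta> where "0 < \<delta>" and \<delta>: "\<And>I. finite I \<Longrightarrow>
       (\<forall>(c, d)\<in>I. a \<le> c \<and> c \<le> d \<and> d \<le> b) \<Longrightarrow>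
       disjoint_family_on (\<lambda>(c, d). {c<..<d}) I \<Longrightarrow>
       (\<Sum>(c, d)\<in>I. d - c) < \<delta> \<Longrightarrow>
       (\<Sum>(c, d)\<in>I. norm (u d - u c)) < e"
    using assms(1) unfolding absolutely_continuous_on_interval_def by meson
  have le: "(\<Sum>(c, d)\<in>I. norm (u d \<bullet> i - u c \<bullet> i)) \<le> (\<Sum>(c, d)\<in>I. norm (u d - u c))" for I
    using Basis_le_norm[OF i] by (intro sum_mono) (auto simp flip: inner_diff_left)
  show "\<exists>\<delta>>0. \<forall>I. finite I \<longrightarrow> (\<forall>(c, d)\<in>I. a \<le> c \<and> c \<le> d \<and> d \<le> b) \<longrightarrow>
      disjoint_family_on (\<lambda>(c, d). {c<..<d}) I \<longrightarrow> (\<Sum>(c, d)\<in>I. d - c) < \<delta> \<longrightarrow>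
      (\<Sum>(c, d)\<in>I. norm (u d \<bullet> i - u c \<bullet> i)) < e"
    by (intro exI[of _ \<delta>] conjI allI impI \<open>0 < \<delta>\<close> order.strict_trans1[OF le] \<delta>)
qed

text \<open>Induction on the number of steps of length \<open>h\<close> that reach from
  \<open>a\<close> to the right endpoint. It carries properties of short intervals, where the
  variation is controlled directly, over to the whole interval.\<close>

lemma interval_split_induct:
  fixes a b h :: real
  assumes "0 < h" "a \<le> b"
    and small: "\<And>c d. a \<le> c \<Longrightarrow> c \<le> d \<Longrightarrow> d \<le> b \<Longrightarrow> d - c \<le> h \<Longrightarrow> P c d"
    and join: "\<And>c m d. c \<le> m \<Longrightarrow> m \<le> d \<Longrightarrow> P c m \<Longrightarrow> P m d \<Longrightarrow> P c d"
  shows "P a b"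
proof -
  have "P a d" if "a \<le> d" "d \<le> b" "d - a \<le> real (Suc n) * h" for n d
    using that
  proof (induction n arbitrary: d)
    case 0
    then show ?case by (intro small) auto
  next
    case (Suc n)
    \<comment> \<open>The last piece has length at most \<open>h\<close>; the maximum keeps the cut
      inside the interval when less than \<open>h\<close> remains.\<close>
    define m where "m = max a (d - h)"
    have m: "a \<le> m" "m \<le> d" "d - m \<le> h" "m - a \<le> real (Suc n) * h"
      using Suc.prems \<open>0 < h\<close> by (auto simp: m_def algebra_simps max_def)
    then show ?case
      using Suc by (intro join[of a m d] Suc.IH small) auto
  qed
  moreover obtain n where "(b - a) / h \<le> real n"
    using real_arch_simple by blast
  then have "b - a \<le> real (Suc n) * h"
    using \<open>0 < h\<close> by (simp add: field_simps)
  ultimately show ?thesis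
    using \<open>a \<le> b\<close> by blast
qed

text \<open>Apply absolute continuity with tolerance 1: the cells of any division of a short
  interval have total length equal to that of the interval. Halving \<open>\<delta>\<close> turns
  the strict bound on lengths into a non-strict one.\<close>

lemma absolutely_continuous_small_variation:
  assumes u: "absolutely_continuous_on_interval a b u"
  shows "\<exists>h>0. \<forall>c d D. a \<le> c \<longrightarrow> c \<le> d \<longrightarrow> d \<le> b \<longrightarrow> d - c \<le> h \<longrightarrow> D division_of {c..d} \<longrightarrow>
    (\<Sum>K\<in>D. norm (u (Sup K) - u (Inf K))) \<le> 1"
proof -
  obtain \<delta> where "0 < \<delta>" and \<delta>: "\<And>D. D division_of \<Union>D \<Longrightarrow> \<Union>D \<subseteq> {a..b} \<Longrightarrow>
      (\<Sum>K\<in>D. Sup K - Inf K) < \<delta> \<Longrightarrow> (\<Sum>K\<in>D. norm (u (Sup K) - u (Inf K))) < 1"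
    using absolutely_continuous_on_intervalD[OF u zero_less_one] by blast
  show ?thesis
  proof (intro exI[of _ "\<delta> / 2"] conjI allI impI)
    fix c d D
    assume *: "a \<le> c" "c \<le> d" "d \<le> b" "d - c \<le> \<delta> / 2" and D: "D division_of {c..d}"
    show "(\<Sum>K\<in>D. norm (u (Sup K) - u (Inf K))) \<le> 1"
    proof (rule less_imp_le, rule \<delta>)
      show "D division_of \<Union>D"
        using D division_ofD(6)[OF D] by simp
      show "\<Union>D \<subseteq> {a..b}"
        using division_ofD(6)[OF D] * by simp
      show "(\<Sum>K\<in>D. Sup K - Inf K) < \<delta>"
        using sum_increments_division[OF D, of "\<lambda>x. x"] * \<open>0 < \<delta>\<close> by simp
    qed
  qed (use \<open>0 < \<delta>\<close> in simp)
qed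

text \<open>Short pieces have variation at most 1 and fall under
  \<open>negligible_not_differentiable_bv\<close>. Joining two open pieces adds only the cut
  point.\<close>

lemma negligible_not_differentiable_ac_real:
  fixes u :: "real \<Rightarrow> real"
  assumes "a \<le> b" and u: "absolutely_continuous_on_interval a b u"
  shows "negligible {x\<in>{a<..<b}. \<not> u differentiable at x}"
proof -
  obtain h where h: "0 < h" "\<And>c d D. \<lbrakk>a \<le> c; c \<le> d; d \<le> b; d - c \<le> h; D division_of {c..d}\<rbrakk>
      \<Longrightarrow> (\<Sum>K\<in>D. norm (u (Sup K) - u (Inf K))) \<le> 1"
    using absolutely_continuous_small_variation[OF u] by blast
  show ?thesis
  proof (rule interval_split_induct[OF h(1) \<open>a \<le> b\<close>])
    fix c d assume *: "a \<le> c" "c \<le> d" "d \<le> b" "d - c \<le> h"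
    show "negligible {x\<in>{c<..<d}. \<not> u differentiable at x}"
    proof (cases "c < d")
      case True
      then show ?thesis
        using h(2)[OF *] by (intro negligible_not_differentiable_bv[of c d u 1]) auto
    next
      case False
      then have "{x\<in>{c<..<d}. \<not> u differentiable at x} = {}"
        by auto
      then show ?thesis by (metis negligible_empty)
    qed
  next
    fix c m d
    assume "negligible {x\<in>{c<..<m}. \<not> u differentiable at x}"
      and "negligible {x\<in>{m<..<d}. \<not> u differentiable at x}"
    then have "negligible ({x\<in>{c<..<m}. \<not> u differentiable at x}
        \<union> {x\<in>{m<..<d}. \<not> u differentiable at x} \<union> {m})"
      by (intro negligible_Un) auto
    then show "negligible {x\<in>{c<..<d}. \<not> u differentiable at x}"
      by (rule negligible_subset) auto
  qed
qed

lemma negligible_not_differentiable_ac: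
  fixes u :: "real \<Rightarrow> 'a::euclidean_space"
  assumes "a \<le> b" and u: "absolutely_continuous_on_interval a b u"
  shows "negligible {x\<in>{a<..<b}. \<not> u differentiable at x}"
proof (rule negligible_subset)
  show "negligible (\<Union>i\<in>Basis. {x\<in>{a<..<b}. \<not> (\<lambda>x. u x \<bullet> i) differentiable at x})"
    using negligible_not_differentiable_ac_real[OF \<open>a \<le> b\<close> absolutely_continuous_on_interval_inner[OF u]]
    by (intro negligible_Union) (auto simp del: greaterThanLessThan_iff)
  show "{x\<in>{a<..<b}. \<not> u differentiable at x}
      \<subseteq> (\<Union>i\<in>Basis. {x\<in>{a<..<b}. \<not> (\<lambda>x. u x \<bullet> i) differentiable at x})"
    using differentiable_componentwise_within[of u _ UNIV] by auto
qed

section \<open>The fundamental theorem of calculus for absolutely continuous functions\<close>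

text \<open>The gauge treats two kinds of tags. At a good tag it enforces the linear approximation
  of \<open>u\<close> with slope error \<open>\<eta>\<close>; at an exceptional tag it keeps the
  cell inside an open set of measure below \<open>\<delta>\<close>, so absolute continuity bounds
  the sum of the increments over all such cells.\<close>

lemma has_integral_vector_derivative_ac:
  fixes u :: "real \<Rightarrow> 'a::banach"
  assumes "a \<le> b" and u: "absolutely_continuous_on_interval a b u" and N: "negligible N"
    and deriv: "\<And>x. x \<in> {a<..<b} - N \<Longrightarrow> (u has_vector_derivative f x) (at x)"
  shows "(f has_integral u b - u a) {a..b}"
proof -
  \<comment> \<open>The derivative is given only in the open interval, so both endpoints count as
    exceptional. Since \<open>g\<close> is 0 on \<open>N'\<close>, exceptional tags contribute
    nothing to the Riemann sum, and only the increments of \<open>u\<close> remain there.\<close>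
  define N' where "N' = insert a (insert b N)"
  define g where "g x = (if x \<in> N' then 0 else f x)" for x
  have N': "negligible N'"
    using N by (simp add: N'_def)
  have "(g has_integral u b - u a) (cbox a b)"
    unfolding has_integral
  proof (intro allI impI)
    fix e :: real assume "0 < e"
    obtain \<delta> where "0 < \<delta>" and \<delta>: "\<And>D. D division_of \<Union>D \<Longrightarrow> \<Union>D \<subseteq> {a..b} \<Longrightarrow>
        (\<Sum>K\<in>D. Sup K - Inf K) < \<delta> \<Longrightarrow> (\<Sum>K\<in>D. norm (u (Sup K) - u (Inf K))) < e / 2"
      using absolutely_continuous_on_intervalD[OF u half_gt_zero[OF \<open>0 < e\<close>]] by blast
    obtain U where U: "open U" "N' \<subseteq> U" "U - N' \<in> lmeasurable" "emeasure lebesgue (U - N') < ennreal \<delta>"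
      using sets_lebesgue_outer_open[OF negligible_imp_sets[OF N'] \<open>0 < \<delta>\<close>] by metis
    have U_eq: "U = (U - N') \<union> N'"
      using U(2) by blast
    have U_meas: "U \<in> lmeasurable"
      using U(3) negligible_imp_measurable[OF N'] U_eq by (metis fmeasurable.Un)
    have "measure lebesgue (U - N' \<union> N') \<le> measure lebesgue (U - N') + measure lebesgue N'"
      using U(3) N' by (intro measure_Un_le) (auto simp: negligible_imp_sets)
    also have "\<dots> < \<delta>"
      using U(3,4) negligible_imp_measure0[OF N'] \<open>0 < \<delta>\<close>
      by (simp add: emeasure_eq_measure2 ennreal_less_iff)
    finally have U_small: "measure lebesgue U < \<delta>"
      using U_eq by simp
    \<comment> \<open>The errors at good tags add up to at most \<open>\<eta> * (b - a)\<close>; the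
      summand 1 makes the denominator positive and the bound \<open>e / 2\<close> strict.\<close>
    define \<eta> where "\<eta> = e / (2 * (b - a + 1))"
    have \<eta>: "0 < \<eta>" "\<eta> * (b - a) < e / 2"
      using \<open>0 < e\<close> \<open>a \<le> b\<close> by (auto simp: \<eta>_def field_simps)
    have "\<exists>d>0. ball x d \<subseteq> U" if "x \<in> N'" for x
      using U that openE by blast
    moreover have "\<exists>d>0. \<forall>y. norm (y - x) < d \<longrightarrow>
        norm (u y - u x - (y - x) *\<^sub>R f x) \<le> \<eta> * norm (y - x)" if "x \<in> {a..b} - N'" for x
    proof -
      have "x \<in> {a<..<b} - N"
        using that by (auto simp: N'_def)
      from deriv[OF this] \<eta>(1) show ?thesis
        unfolding has_vector_derivative_def has_derivative_at_alt by blast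
    qed
    ultimately have "\<exists>d>0. (x \<in> N' \<longrightarrow> ball x d \<subseteq> U) \<and> (x \<in> {a..b} - N' \<longrightarrow>
        (\<forall>y. norm (y - x) < d \<longrightarrow> norm (u y - u x - (y - x) *\<^sub>R f x) \<le> \<eta> * norm (y - x)))" for x
      by (cases "x \<in> N'"; cases "x \<in> {a..b}") (auto intro: zero_less_one)
    then obtain d where d: "\<And>x. 0 < d x" "\<And>x. x \<in> N' \<Longrightarrow> ball x (d x) \<subseteq> U"
      "\<And>x y. \<lbrakk>x \<in> {a..b} - N'; norm (y - x) < d x\<rbrakk>
        \<Longrightarrow> norm (u y - u x - (y - x) *\<^sub>R f x) \<le> \<eta> * norm (y - x)"
      by metis
    show "\<exists>\<gamma>. gauge \<gamma> \<and> (\<forall>p. p tagged_division_of cbox a b \<and> \<gamma> fine p \<longrightarrow>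
        norm ((\<Sum>(x, K)\<in>p. measure lborel K *\<^sub>R g x) - (u b - u a)) < e)"
    proof (intro exI[of _ "\<lambda>x. ball x (d x)"] conjI allI impI)
      show "gauge (\<lambda>x. ball x (d x))"
        using d(1) by (rule gauge_ball_dependent[rule_format])
      fix p assume "p tagged_division_of cbox a b \<and> (\<lambda>x. ball x (d x)) fine p"
      then have p: "p tagged_division_of {a..b}" and fine: "(\<lambda>x. ball x (d x)) fine p"
        by (auto simp: cbox_interval)
      have "finite p"
        using p by blast
      have pD: "\<exists>l r. K = {l..r} \<and> l \<le> r \<and> x \<in> {l..r} \<and> {l..r} \<subseteq> {a..b} \<and> {l..r} \<subseteq> ball x (d x)"
        if "(x, K) \<in> p" for x K
        using tagged_division_ofD(2,3,4)[OF p that] fineD[OF fine that] by (fastforce simp: cbox_interval)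
      define \<nu> where "\<nu> K = u (Sup K) - u (Inf K)" for K
      define q where "q = {(x, K) \<in> p. x \<in> N'}"
      have "q \<subseteq> p" by (auto simp: q_def)
      have good: "(\<Sum>(x, K)\<in>p - q. norm (measure lborel K *\<^sub>R g x - \<nu> K)) \<le> \<eta> * (b - a)"
      proof -
        have "(\<Sum>(x, K)\<in>p - q. norm (measure lborel K *\<^sub>R g x - \<nu> K)) \<le> (\<Sum>(x, K)\<in>p - q. \<eta> * measure lborel K)"
        proof (intro sum_mono, clarify)
          fix x K assume xK: "(x, K) \<in> p" "(x, K) \<notin> q"
          then obtain l r where lr: "K = {l..r}" "l \<le> r" "x \<in> {l..r}" "{l..r} \<subseteq> {a..b}"
              "{l..r} \<subseteq> ball x (d x)"
            using pD by blast
          have "x \<in> {a..b} - N'"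
            using xK lr by (auto simp: q_def)
          moreover have "l \<in> ball x (d x)" "r \<in> ball x (d x)"
            using subsetD[OF lr(5), of l] subsetD[OF lr(5), of r] lr(2) by simp_all
          ultimately have l: "norm (u l - u x - (l - x) *\<^sub>R f x) \<le> \<eta> * norm (l - x)"
            and r: "norm (u r - u x - (r - x) *\<^sub>R f x) \<le> \<eta> * norm (r - x)"
            using d(3)[of x l] d(3)[of x r] by (simp_all add: dist_real_def abs_minus_commute)
          \<comment> \<open>Straddle lemma: the tag lies between \<open>l\<close> and
            \<open>r\<close>, so the terms \<open>u x\<close> cancel and the distances from
            \<open>x\<close> to the two endpoints add up to the length of \<open>K\<close>.\<close>
          have "measure lborel K *\<^sub>R g x - \<nu> K
              = (u l - u x - (l - x) *\<^sub>R f x) - (u r - u x - (r - x) *\<^sub>R f x)"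
            using \<open>x \<in> {a..b} - N'\<close> lr by (simp add: \<nu>_def g_def algebra_simps)
          then have "norm (measure lborel K *\<^sub>R g x - \<nu> K) \<le> \<eta> * norm (l - x) + \<eta> * norm (r - x)"
            using l r norm_triangle_ineq4 by (smt (verit))
          also have "\<dots> = \<eta> * measure lborel K"
            using lr by (simp add: algebra_simps)
          finally show "norm (measure lborel K *\<^sub>R g x - \<nu> K) \<le> \<eta> * measure lborel K" .
        qed
        also have "\<dots> \<le> (\<Sum>(x, K)\<in>p. \<eta> * measure lborel K)"
          using \<open>finite p\<close> \<eta> by (intro sum_mono2) auto
        also have "\<dots> = \<eta> * (b - a)"
          using additive_content_tagged_division[of p a b] p \<open>a \<le> b\<close>
          by (simp add: case_prod_beta cbox_interval flip: sum_distrib_left)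
        finally show ?thesis .
      qed
      have bad: "(\<Sum>(x, K)\<in>q. norm (measure lborel K *\<^sub>R g x - \<nu> K)) < e / 2"
      proof -
        have q: "q tagged_division_of \<Union>(snd ` q)"
          using tagged_partial_division_of_Union_self[OF tagged_partial_division_subset[OF _ \<open>q \<subseteq> p\<close>]] p
          by (auto simp: tagged_division_of_def)
        then have D: "snd ` q division_of \<Union>(snd ` q)"
          by (rule division_of_tagged_division)
        \<comment> \<open>A cell can carry two tags only if its interior is empty. As
          \<open>\<nu>'\<close> vanishes on such cells, including the empty one, the sum over tagged
          cells equals the sum over cells.\<close>
        define \<nu>' where "\<nu>' K = (if K = {} then 0 else norm (\<nu> K))" for K
        have ne: "K \<noteq> {}" if "(x, K) \<in> q" for x K
          using pD[of x K] that \<open>q \<subseteq> p\<close> by auto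
        have "(\<Sum>(x, K)\<in>q. norm (measure lborel K *\<^sub>R g x - \<nu> K)) = (\<Sum>(x, K)\<in>q. \<nu>' K)"
          using ne by (intro sum.cong refl) (auto simp: q_def g_def \<nu>'_def)
        also have "\<dots> = (\<Sum>K\<in>snd ` q. \<nu>' K)"
          by (rule sum.over_tagged_division_lemma[OF q]) (auto simp: \<nu>'_def \<nu>_def cbox_interval)
        also have "\<dots> = (\<Sum>K\<in>snd ` q. norm (u (Sup K) - u (Inf K)))"
          using ne by (intro sum.cong refl) (auto simp: \<nu>'_def \<nu>_def)
        also have "\<dots> < e / 2"
        proof (rule \<delta>[OF D])
          show "\<Union>(snd ` q) \<subseteq> {a..b}"
            using pD \<open>q \<subseteq> p\<close> by fastforce
          have sub: "\<Union>(snd ` q) \<subseteq> U"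
          proof clarsimp
            fix x K y assume "(x, K) \<in> q" "y \<in> K"
            then show "y \<in> U"
              using pD[of x K] d(2)[of x] by (auto simp: q_def)
          qed
          have "(\<Sum>K\<in>snd ` q. Sup K - Inf K) = (\<Sum>K\<in>snd ` q. measure lebesgue K)"
          proof (intro sum.cong refl)
            fix K assume "K \<in> snd ` q"
            then obtain x where "(x, K) \<in> p"
              using \<open>q \<subseteq> p\<close> by auto
            then show "Sup K - Inf K = measure lebesgue K"
              using pD by force
          qed
          also have "\<dots> = measure lebesgue (\<Union>(snd ` q))"
            using content_division[OF D] by simp
          also have "\<dots> \<le> measure lebesgue U"
            using sub U_meas lmeasurable_division[OF D] by (intro measure_mono_fmeasurable) auto
          finally show "(\<Sum>K\<in>snd ` q. Sup K - Inf K) < \<delta>"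
            using U_small by simp
        qed
        finally show ?thesis .
      qed
      have "(\<Sum>(x, K)\<in>p. measure lborel K *\<^sub>R g x) - (u b - u a) = (\<Sum>(x, K)\<in>p. measure lborel K *\<^sub>R g x - \<nu> K)"
        using additive_tagged_division_1[OF \<open>a \<le> b\<close> p, of u]
        by (simp add: \<nu>_def case_prod_beta sum_subtractf)
      also have "norm \<dots> \<le> (\<Sum>(x, K)\<in>p. norm (measure lborel K *\<^sub>R g x - \<nu> K))"
        by (rule sum_norm_le) auto
      also have "\<dots> = (\<Sum>(x, K)\<in>p - q. norm (measure lborel K *\<^sub>R g x - \<nu> K))
          + (\<Sum>(x, K)\<in>q. norm (measure lborel K *\<^sub>R g x - \<nu> K))"
        by (rule sum.subset_diff[OF \<open>q \<subseteq> p\<close> \<open>finite p\<close>])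
      also have "\<dots> < e"
        using good bad \<eta>(2) by simp
      finally show "norm ((\<Sum>(x, K)\<in>p. measure lborel K *\<^sub>R g x) - (u b - u a)) < e" .
    qed
  qed
  then have "(g has_integral u b - u a) {a..b}"
    by (simp add: cbox_interval)
  then show ?thesis
    by (rule has_integral_spike[OF N', rotated]) (auto simp: g_def)
qed

text \<open>The gauge integral does not by itself give Lebesgue integrability. That follows because
  the integrals of the derivative over the cells of a division are increments of \<open>u\<close>,
  whose sum is bounded on short intervals; finitely many of these are then glued together.\<close>

theorem absolutely_continuous_integral_vector_derivative:
  fixes u :: "real \<Rightarrow> 'a::euclidean_space"
  assumes "a \<le> b" and u: "absolutely_continuous_on_interval a b u"
  shows "set_integrable lebesgue {a..b} (\<lambda>x. vector_derivative u (at x))"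
    and "set_lebesgue_integral lebesgue {a..b} (\<lambda>x. vector_derivative u (at x)) = u b - u a"
proof -
  let ?f = "\<lambda>x. vector_derivative u (at x)"
  have ftc: "(?f has_integral u d - u c) {c..d}" if "a \<le> c" "c \<le> d" "d \<le> b" for c d
  proof (rule has_integral_vector_derivative_ac[OF \<open>c \<le> d\<close>])
    show ac: "absolutely_continuous_on_interval c d u"
      using absolutely_continuous_on_interval_subinterval[OF u] that by simp
    show "negligible {x\<in>{c<..<d}. \<not> u differentiable at x}"
      using negligible_not_differentiable_ac[OF \<open>c \<le> d\<close> ac] .
    show "(u has_vector_derivative ?f x) (at x)"
      if "x \<in> {c<..<d} - {x\<in>{c<..<d}. \<not> u differentiable at x}" for x
      using that vector_derivative_works by auto
  qed
  obtain h where h: "0 < h" "\<And>c d D. \<lbrakk>a \<le> c; c \<le> d; d \<le> b; d - c \<le> h; D division_of {c..d}\<rbrakk>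
      \<Longrightarrow> (\<Sum>K\<in>D. norm (u (Sup K) - u (Inf K))) \<le> 1"
    using absolutely_continuous_small_variation[OF u] by blast
  show int: "set_integrable lebesgue {a..b} ?f"
  proof (rule interval_split_induct[OF h(1) \<open>a \<le> b\<close>])
    fix c d assume cd: "a \<le> c" "c \<le> d" "d \<le> b" "d - c \<le> h"
    have "?f absolutely_integrable_on cbox c d"
    proof (rule bounded_variation_absolutely_integrable_interval)
      show "?f integrable_on cbox c d"
        using ftc[OF cd(1-3)] by (auto simp: cbox_interval)
      fix D assume "D division_of cbox c d"
      then have D: "D division_of {c..d}"
        by (simp add: cbox_interval)
      have "(\<Sum>K\<in>D. norm (integral K ?f)) = (\<Sum>K\<in>D. norm (u (Sup K) - u (Inf K)))"
      proof (intro sum.cong refl)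
        fix K assume K: "K \<in> D"
        then obtain l r where "K = {l..r}" "l \<le> r"
          using division_ofD(3,4)[OF D] by (force simp: cbox_interval)
        moreover from this have "c \<le> l" "r \<le> d"
          using division_ofD(2)[OF D K] by auto
        ultimately show "norm (integral K ?f) = norm (u (Sup K) - u (Inf K))"
          using ftc[of l r] cd by (auto dest: integral_unique)
      qed
      also have "\<dots> \<le> 1"
        by (rule h(2)[OF cd D])
      finally show "(\<Sum>K\<in>D. norm (integral K ?f)) \<le> 1" .
    qed
    then show "set_integrable lebesgue {c..d} ?f"
      by (simp add: cbox_interval)
  next
    fix c m d :: real
    assume "c \<le> m" "m \<le> d" "set_integrable lebesgue {c..m} ?f" "set_integrable lebesgue {m..d} ?f"
    then have "set_integrable lebesgue ({c..m} \<union> {m..d}) ?f"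
      by (intro set_integrable_Un) auto
    then show "set_integrable lebesgue {c..d} ?f"
      using \<open>c \<le> m\<close> \<open>m \<le> d\<close> by (simp add: ivl_disj_un_two_touch)
  qed
  show "set_lebesgue_integral lebesgue {a..b} ?f = u b - u a"
    using set_lebesgue_integral_eq_integral(2)[OF int] ftc[OF order.refl \<open>a \<le> b\<close> order.refl]
    by (auto dest: integral_unique)
qed

section \<open>Fractional integrals\<close>

text \<open>Substitute \<open>s = r + (t - r) * x\<close>. The factors \<open>t - r\<close> from the
  two powers and the Jacobian have exponents adding up to 0, so a Beta integral independent of
  \<open>r\<close> and \<open>t\<close> remains, with denominator
  \<open>Gamma 1 = 1\<close>.\<close>

lemma nn_integral_Beta_kernel:
  fixes r t \<alpha> :: real
  assumes "0 < \<alpha>" "\<alpha> < 1" "r < t"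
  shows "(\<integral>\<^sup>+s. ennreal (indicator {r..t} s * ((t - s) powr (\<alpha> - 1) * (s - r) powr (- \<alpha>))) \<partial>lborel)
    = ennreal (Gamma \<alpha> * Gamma (1 - \<alpha>))"
proof -
  let ?k = "\<lambda>s. indicator {r..t} s * ((t - s) powr (\<alpha> - 1) * (s - r) powr (- \<alpha>))"
  have kernel: "(t - r) * ?k (r + (t - r) * x)
      = indicator {0..1} x * (x powr ((1 - \<alpha>) - 1) * (1 - x) powr (\<alpha> - 1))" for x
  proof (cases "x \<in> {0..1}")
    case True
    have "(t - r) * x \<le> t - r" "0 \<le> (t - r) * x"
      using True \<open>r < t\<close> by (auto intro: mult_left_le)
    then have ind: "r + (t - r) * x \<in> {r..t}"
      by auto
    have eq: "t - (r + (t - r) * x) = (t - r) * (1 - x)" "r + (t - r) * x - r = (t - r) * x"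
      by (auto simp: algebra_simps)
    have "(t - r) * ((t - r) powr (\<alpha> - 1) * (t - r) powr (- \<alpha>)) = 1"
      using \<open>r < t\<close> by (simp add: powr_diff powr_minus field_simps)
    then show ?thesis
      using True ind \<open>r < t\<close> unfolding eq by (simp add: powr_mult mult_ac)
  next
    case False
    have "x \<le> 1 \<longleftrightarrow> (t - r) * x \<le> t - r" "0 \<le> x \<longleftrightarrow> 0 \<le> (t - r) * x"
      using \<open>r < t\<close> mult_le_cancel_left_pos[of "t - r" x 1] by (auto simp: zero_le_mult_iff)
    then have "r + (t - r) * x \<notin> {r..t}"
      using False by auto
    then show ?thesis
      using False by simp
  qed
  have "(\<integral>\<^sup>+s. ennreal (?k s) \<partial>lborel) = ennreal \<bar>t - r\<bar> * (\<integral>\<^sup>+x. ennreal (?k (r + (t - r) * x)) \<partial>lborel)"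
    using \<open>r < t\<close> by (intro nn_integral_real_affine) auto
  also have "\<dots> = (\<integral>\<^sup>+x. ennreal ((t - r) * ?k (r + (t - r) * x)) \<partial>lborel)"
    using \<open>r < t\<close> by (subst nn_integral_cmult[symmetric]) (auto simp: ennreal_mult')
  also have "\<dots> = ennreal (Beta (1 - \<alpha>) \<alpha>)"
    unfolding kernel
    by (rule nn_integral_has_integral_lebesgue[OF _ has_integral_Beta_real]) (use assms in auto)
  also have "Beta (1 - \<alpha>) \<alpha> = Gamma \<alpha> * Gamma (1 - \<alpha>)"
    by (simp add: Beta_def)
  finally show ?thesis .
qed

text \<open>A Borel representative makes the two-variable integrand measurable for the product of
  two copies of \<open>lborel\<close>, as Fubini's theorem requires. It is built componentwise, and
  the finitely many exceptional null sets are combined.\<close>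

lemma AE_lborel_ex_borel_measurable:
  fixes f :: "'b::euclidean_space \<Rightarrow> 'a::euclidean_space"
  assumes f: "f \<in> borel_measurable lebesgue"
  shows "\<exists>g \<in> borel_measurable borel. AE x in lborel. f x = g x"
proof -
  have "\<exists>g \<in> borel_measurable lborel. AE x in lborel. f x \<bullet> i = g x" for i
    using f by (intro completion_ex_borel_measurable_real) auto
  then obtain g where g: "\<And>i. g i \<in> borel_measurable lborel" "\<And>i. AE x in lborel. f x \<bullet> i = g i x"
    by metis
  show ?thesis
  proof
    show "(\<lambda>x. \<Sum>i\<in>Basis. g i x *\<^sub>R i) \<in> borel_measurable borel"
      using g(1) by auto
    have "AE x in lborel. \<forall>i\<in>Basis. f x \<bullet> i = g i x"
      using g(2) by (intro AE_finite_allI) auto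
    then show "AE x in lborel. f x = (\<Sum>i\<in>Basis. g i x *\<^sub>R i)"
    proof eventually_elim
      case (elim x)
      then have "(\<Sum>i\<in>Basis. g i x *\<^sub>R i) = (\<Sum>i\<in>Basis. (f x \<bullet> i) *\<^sub>R i)"
        by (intro sum.cong) auto
      then show ?case
        by (simp add: euclidean_representation)
    qed
  qed
qed

text \<open>By Fubini the iterated integral becomes the integral of \<open>f r\<close> against the
  inner integral of the kernel over \<open>s\<close> between \<open>r\<close> and \<open>t\<close>.
  That inner integral is the constant \<open>c\<close>, which the two Gamma normalisations
  cancel.\<close>

theorem rl_integral_complementary:
  fixes f :: "real \<Rightarrow> 'a::euclidean_space"
  assumes \<alpha>: "0 < \<alpha>" "\<alpha> < 1" and f: "set_integrable lebesgue {a..t} f"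
  shows "rl_integral a \<alpha> (rl_integral a (1 - \<alpha>) f) t = set_lebesgue_integral lebesgue {a..t} f"
proof -
  define c where "c = Gamma \<alpha> * Gamma (1 - \<alpha>)"
  have \<Gamma>: "0 < Gamma \<alpha>" "0 < Gamma (1 - \<alpha>)" and "0 < c"
    using \<alpha> by (auto simp: c_def)
  let ?f = "\<lambda>s. indicator {a..t} s *\<^sub>R f s"
  have f_meas: "?f \<in> borel_measurable lebesgue" and f_int: "integrable lebesgue ?f"
    using f by (auto simp: set_integrable_def)
  obtain F where F [measurable]: "F \<in> borel_measurable borel" and FAE: "AE s in lborel. ?f s = F s"
    using AE_lborel_ex_borel_measurable[OF f_meas] by blast
  have F_int: "integrable lborel F"
    using integrable_cong_AE_imp[OF f_int measurable_completion AE_completion[OF FAE]]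
    by (simp add: integrable_completion)
  \<comment> \<open>The cut at \<open>t\<close> is half-open because the kernel integral equals
    \<open>c\<close> only for \<open>r < t\<close>. For all other \<open>r\<close> the function
    \<open>G\<close> vanishes, so the inner integrals below have the same form for every
    \<open>r\<close>.\<close>
  define G where "G r = indicator {a..<t} r *\<^sub>R F r" for r
  have [measurable]: "G \<in> borel_measurable borel"
    unfolding G_def by measurable
  have G_int: "integrable lborel G"
    unfolding G_def using integrable_mult_indicator[OF _ F_int] by simp
  have GAE: "AE r in lebesgue. G r = indicator {a..<t} r *\<^sub>R ?f r"
    using AE_completion[OF FAE] by eventually_elim (simp add: G_def)
  define k where "k s r = indicator {r..t} s * ((t - s) powr (\<alpha> - 1) * (s - r) powr (- \<alpha>))" for s r :: real
  have k_eq: "k s r = (if r \<le> s \<and> s \<le> t then (t - s) powr (\<alpha> - 1) * (s - r) powr (- \<alpha>) else 0)" for s r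
    by (simp add: k_def)
  have k_meas [measurable]: "(\<lambda>(s, r). k s r) \<in> borel_measurable (borel \<Otimes>\<^sub>M borel)"
    unfolding k_eq by measurable
  have k_nonneg: "0 \<le> k s r" for s r
    by (simp add: k_def)
  have k_int: "integrable lborel (\<lambda>s. k s r)" "(LINT s|lborel. k s r) = c" if "r < t" for r
  proof -
    have "has_bochner_integral lborel (\<lambda>s. k s r) c"
      using nn_integral_Beta_kernel[OF \<alpha> that] \<open>0 < c\<close> k_nonneg
      by (intro has_bochner_integral_nn_integral) (auto simp: k_def c_def)
    then show "integrable lborel (\<lambda>s. k s r)" "(LINT s|lborel. k s r) = c"
      by (auto simp: has_bochner_integral_iff)
  qed
  have inner_int: "integrable lborel (\<lambda>s. k s r *\<^sub>R G r)" for r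
    using k_int(1)[of r] by (cases "r < t") (auto simp: G_def)
  have inner_norm: "(LINT s|lborel. norm (k s r *\<^sub>R G r)) = c * norm (G r)" for r
    using k_int[of r] k_nonneg by (cases "r < t") (auto simp: G_def)
  have inner: "(LINT s|lborel. k s r *\<^sub>R G r) = c *\<^sub>R G r" for r
    using k_int[of r] by (cases "r < t") (auto simp: G_def)
  have joint: "integrable (lborel \<Otimes>\<^sub>M lborel) (\<lambda>(r, s). k s r *\<^sub>R G r)"
  proof (rule lborel_pair.Fubini_integrable)
    show "(\<lambda>(r, s). k s r *\<^sub>R G r) \<in> borel_measurable (lborel \<Otimes>\<^sub>M lborel)"
      by measurable
    show "integrable lborel (\<lambda>r. LINT s|lborel. norm (case (r, s) of (r, s) \<Rightarrow> k s r *\<^sub>R G r))"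
      using G_int by (simp only: prod.case inner_norm) (intro integrable_mult_right integrable_norm)
    show "AE r in lborel. integrable lborel (\<lambda>s. case (r, s) of (r, s) \<Rightarrow> k s r *\<^sub>R G r)"
      using inner_int by simp
  qed
  define K where "K s = (LINT r|lborel. k s r *\<^sub>R G r)" for s
  have [measurable]: "K \<in> borel_measurable borel"
    unfolding K_def by measurable
  have K_eq: "indicator {a..t} s *\<^sub>R ((t - s) powr (\<alpha> - 1) *\<^sub>R rl_integral a (1 - \<alpha>) f s)
      = (1 / Gamma (1 - \<alpha>)) *\<^sub>R K s" for s
  proof (cases "s \<in> {a..<t}")
    case True
    define h where "h r = indicator {a..s} r *\<^sub>R ((s - r) powr (- \<alpha>) *\<^sub>R f r)" for r
    have h_eq: "h r = (indicator {a..s} r * (s - r) powr (- \<alpha>)) *\<^sub>R ?f r" for r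
      using True by (auto simp: h_def indicator_def)
    have "K s = (LINT r|lebesgue. k s r *\<^sub>R G r)"
      unfolding K_def by (rule integral_completion[symmetric]) measurable
    also have "\<dots> = (LINT r|lebesgue. (t - s) powr (\<alpha> - 1) *\<^sub>R h r)"
    proof (rule integral_cong_AE)
      show "(\<lambda>r. k s r *\<^sub>R G r) \<in> borel_measurable lebesgue"
        by (rule measurable_completion) measurable
      have m: "(\<lambda>r. indicator {a..s} r * (s - r) powr (- \<alpha>)) \<in> borel_measurable lebesgue"
        by (rule measurable_completion) measurable
      show "(\<lambda>r. (t - s) powr (\<alpha> - 1) *\<^sub>R h r) \<in> borel_measurable lebesgue"
        unfolding h_eq
        by (rule borel_measurable_scaleR[OF borel_measurable_const borel_measurable_scaleR[OF m f_meas]])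
      show "AE r in lebesgue. k s r *\<^sub>R G r = (t - s) powr (\<alpha> - 1) *\<^sub>R h r"
        using GAE by eventually_elim (use True in \<open>auto simp: h_def k_eq indicator_def\<close>)
    qed
    \<comment> \<open>Pulling out the constant is valid for every \<open>s\<close>: if
      \<open>h\<close> is not integrable, both integrals take the default value 0.\<close>
    also have "\<dots> = (t - s) powr (\<alpha> - 1) *\<^sub>R (LINT r|lebesgue. h r)"
      by simp
    also have "(LINT r|lebesgue. h r) = Gamma (1 - \<alpha>) *\<^sub>R rl_integral a (1 - \<alpha>) f s"
      using \<alpha> \<Gamma>(2)[THEN less_imp_neq, symmetric] by (simp add: h_def rl_integral_def set_lebesgue_integral_def)
    finally show ?thesis
      using True \<Gamma>(2)[THEN less_imp_neq, symmetric] by simp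
  next
    case False
    \<comment> \<open>At \<open>s = t\<close> this rests on the convention
      \<open>0 powr x = 0\<close>, which also makes the left-hand side of the claim vanish there.
      For \<open>s < a\<close> the supports of the kernel and of \<open>G\<close> are disjoint, and
      for \<open>s > t\<close> the kernel is 0.\<close>
    then have "k s r *\<^sub>R G r = 0" for r
      by (auto simp: k_eq G_def indicator_def)
    then have "(\<lambda>r. k s r *\<^sub>R G r) = (\<lambda>r. 0)"
      by (rule ext)
    then have "K s = 0"
      unfolding K_def by (simp only: integral_zero)
    with False show ?thesis
      by (auto simp: indicator_def)
  qed
  have "rl_integral a \<alpha> (rl_integral a (1 - \<alpha>) f) t
      = (1 / Gamma \<alpha>) *\<^sub>R (LINT s|lebesgue. (1 / Gamma (1 - \<alpha>)) *\<^sub>R K s)"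
    unfolding rl_integral_def[of a \<alpha>] set_lebesgue_integral_def K_eq using \<alpha> by simp
  also have "(LINT s|lebesgue. (1 / Gamma (1 - \<alpha>)) *\<^sub>R K s) = (1 / Gamma (1 - \<alpha>)) *\<^sub>R (LINT s|lborel. K s)"
    by (simp add: integral_completion)
  also have "(LINT s|lborel. K s) = (LINT r|lborel. c *\<^sub>R G r)"
    unfolding K_def using lborel_pair.Fubini_integral[OF joint] by (simp add: inner)
  also have "\<dots> = c *\<^sub>R (LINT r|lebesgue. G r)"
    by (simp add: integral_completion)
  also have "(LINT r|lebesgue. G r) = (LINT r|lebesgue. ?f r)"
  proof (rule integral_cong_AE)
    show "G \<in> borel_measurable lebesgue"
      by (rule measurable_completion) measurable
    have "AE r in lebesgue. r \<noteq> t"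
      by (intro AE_completion AE_lborel_singleton)
    with GAE show "AE r in lebesgue. G r = ?f r"
      by eventually_elim (auto simp: indicator_def)
  qed (rule f_meas)
  finally show ?thesis
    using \<Gamma> by (simp add: c_def set_lebesgue_integral_def)
qed

section \<open>Hoelder's inequality, the inversion formula and the pointwise bound\<close>

text \<open>Young's inequality for \<open>f\<close> and \<open>g\<close> divided by their norms.
  Adding \<open>e > 0\<close> to both norms avoids separate cases for norm 0, and \<open>e\<close>
  tends to 0 at the end. The same pointwise estimate gives integrability of the product.\<close>

lemma Holder_inequality:
  fixes f g :: "'b \<Rightarrow> real"
  assumes pq: "1 < p" "1 < q" "1 / p + 1 / q = 1"
    and [measurable]: "f \<in> borel_measurable M" "g \<in> borel_measurable M"
    and nonneg: "\<And>x. 0 \<le> f x" "\<And>x. 0 \<le> g x"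
    and int: "integrable M (\<lambda>x. f x powr p)" "integrable M (\<lambda>x. g x powr q)"
  shows "(LINT x|M. f x * g x) \<le> (LINT x|M. f x powr p) powr (1 / p) * (LINT x|M. g x powr q) powr (1 / q)"
proof -
  define A where "A = (LINT x|M. f x powr p)"
  define B where "B = (LINT x|M. g x powr q)"
  have AB: "0 \<le> A" "0 \<le> B"
    by (auto simp: A_def B_def)
  have bound: "(LINT x|M. f x * g x) \<le> (A powr (1 / p) + e) * (B powr (1 / q) + e)" if "0 < e" for e
  proof -
    define a where "a = A powr (1 / p) + e"
    define b where "b = B powr (1 / q) + e"
    have ab: "0 < a" "0 < b"
      using that by (auto simp: a_def b_def add_nonneg_pos)
    have "A = (A powr (1 / p)) powr p"
      using pq AB by (simp add: powr_powr)
    also have "\<dots> \<le> a powr p"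
      using pq that by (intro powr_mono2) (auto simp: a_def)
    finally have A_le: "A / a powr p \<le> 1"
      using ab by simp
    have "B = (B powr (1 / q)) powr q"
      using pq AB by (simp add: powr_powr)
    also have "\<dots> \<le> b powr q"
      using pq that by (intro powr_mono2) (auto simp: b_def)
    finally have B_le: "B / b powr q \<le> 1"
      using ab by simp
    let ?h = "\<lambda>x. a * b * (f x powr p / (a powr p * p) + g x powr q / (b powr q * q))"
    have h_int: "integrable M ?h"
      using int by auto
    have le: "f x * g x \<le> ?h x" for x
    proof -
      have "f x * g x = a * b * ((f x / a) * (g x / b))"
        using ab by simp
      also have "\<dots> \<le> a * b * ((f x / a) powr p / p + (g x / b) powr q / q)"
        using ab nonneg pq by (intro mult_left_mono Youngs_inequality) auto
      also have "\<dots> = ?h x"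
        using ab nonneg by (simp add: powr_divide)
      finally show ?thesis .
    qed
    have "(LINT x|M. f x * g x) \<le> (LINT x|M. ?h x)"
    proof (rule integral_mono[OF _ h_int le])
      show "integrable M (\<lambda>x. f x * g x)"
        by (rule Bochner_Integration.integrable_bound[OF h_int])
          (use nonneg le in \<open>auto intro!: AE_I2 intro: order.trans[OF _ abs_ge_self]\<close>)
    qed
    also have "\<dots> = a * b * (A / a powr p / p + B / b powr q / q)"
      using int by (simp add: A_def B_def)
    also have "\<dots> \<le> a * b * (1 / p + 1 / q)"
      using ab A_le B_le pq by (intro mult_left_mono add_mono divide_right_mono) auto
    finally show ?thesis
      using pq by (simp add: a_def b_def)
  qed
  have "((\<lambda>e. (A powr (1 / p) + e) * (B powr (1 / q) + e)) \<longlongrightarrow> (A powr (1 / p) + 0) * (B powr (1 / q) + 0)) (at_right 0)"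
    by (intro tendsto_intros)
  moreover have "eventually (\<lambda>e. (LINT x|M. f x * g x) \<le> (A powr (1 / p) + e) * (B powr (1 / q) + e)) (at_right 0)"
    using bound by (auto simp: eventually_at_filter)
  ultimately show ?thesis
    unfolding A_def B_def by (intro tendsto_lowerbound) auto
qed

text \<open>The antiderivative is continuous up to the singular endpoint \<open>s = t\<close>
  because \<open>e + 1 > 0\<close>, so the fundamental theorem with interior derivatives applies;
  nonnegativity upgrades the gauge integral to a Lebesgue integral.\<close>

lemma set_integral_powr_reflected:
  fixes a t e :: real
  assumes "a \<le> t" "- 1 < e"
  shows "set_integrable lebesgue {a..t} (\<lambda>s. (t - s) powr e)"
    and "set_lebesgue_integral lebesgue {a..t} (\<lambda>s. (t - s) powr e) = (t - a) powr (e + 1) / (e + 1)"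
proof -
  have "((\<lambda>s. (t - s) powr e) has_integral
      (- ((t - t) powr (e + 1) / (e + 1)) - - ((t - a) powr (e + 1) / (e + 1)))) {a..t}"
  proof (rule fundamental_theorem_of_calculus_interior[OF \<open>a \<le> t\<close>])
    show "continuous_on {a..t} (\<lambda>s. - ((t - s) powr (e + 1) / (e + 1)))"
      using \<open>- 1 < e\<close> by (intro continuous_intros continuous_on_powr') auto
    fix s assume "s \<in> {a<..<t}"
    then have "((\<lambda>s. - ((t - s) powr (e + 1) / (e + 1))) has_real_derivative (t - s) powr e) (at s)"
      using \<open>- 1 < e\<close> by (auto intro!: derivative_eq_intros)
    then show "((\<lambda>s. - ((t - s) powr (e + 1) / (e + 1))) has_vector_derivative (t - s) powr e) (at s)"
      by (simp add: has_real_derivative_iff_has_vector_derivative)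
  qed
  then have int: "((\<lambda>s. (t - s) powr e) has_integral (t - a) powr (e + 1) / (e + 1)) {a..t}"
    by simp
  show *: "set_integrable lebesgue {a..t} (\<lambda>s. (t - s) powr e)"
    using int by (intro nonnegative_absolutely_integrable_1) auto
  show "set_lebesgue_integral lebesgue {a..t} (\<lambda>s. (t - s) powr e) = (t - a) powr (e + 1) / (e + 1)"
    using set_lebesgue_integral_eq_integral(2)[OF *] int by (auto dest: integral_unique)
qed

text \<open>For \<open>\<alpha> < 1\<close> this is \<open>rl_integral_complementary\<close> applied
  to the derivative of \<open>u\<close>. For \<open>\<alpha> = 1\<close> the Caputo derivative is
  the derivative itself, since the integral of order 0 is the identity, and the fundamental theorem
  suffices.\<close>

theorem rl_integral_caputo_derivative:
  fixes u :: "real \<Rightarrow> 'a::euclidean_space"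
  assumes u: "absolutely_continuous_on_interval a b u" and \<alpha>: "0 < \<alpha>" "\<alpha> \<le> 1" and t: "t \<in> {a..b}"
  shows "rl_integral a \<alpha> (caputo_derivative a \<alpha> u) t = u t - u a"
proof -
  let ?f = "\<lambda>s. vector_derivative u (at s)"
  have "a \<le> t" and ac: "absolutely_continuous_on_interval a t u"
    using absolutely_continuous_on_interval_subinterval[OF u] t by auto
  note ftc = absolutely_continuous_integral_vector_derivative[OF this]
  show ?thesis
  proof (cases "\<alpha> = 1")
    case True
    have f_meas: "(\<lambda>s. indicator {a..t} s *\<^sub>R ?f s) \<in> borel_measurable lebesgue"
      using ftc(1) by (auto simp: set_integrable_def)
    \<comment> \<open>The kernel \<open>(t - s) powr 0\<close> equals 1 for \<open>s < t\<close> but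
      0 at \<open>s = t\<close>, since \<open>0 powr 0 = 0\<close>. Hence the detour through the
      half-open interval.\<close>
    have ind: "(indicator {a..<t} :: real \<Rightarrow> real) \<in> borel_measurable lebesgue"
      by (rule measurable_completion) measurable
    have AE: "AE s in lebesgue. indicator {a..<t} s *\<^sub>R (indicator {a..t} s *\<^sub>R ?f s)
        = indicator {a..t} s *\<^sub>R ?f s"
      using AE_completion[OF AE_lborel_singleton[of t]] by eventually_elim (auto simp: indicator_def)
    have "rl_integral a \<alpha> (caputo_derivative a \<alpha> u) t
        = (LINT s|lebesgue. indicator {a..t} s *\<^sub>R ((t - s) powr 0 *\<^sub>R ?f s))"
      using True by (simp add: rl_integral_def caputo_derivative_def set_lebesgue_integral_def)
    also have "\<dots> = (LINT s|lebesgue. indicator {a..<t} s *\<^sub>R (indicator {a..t} s *\<^sub>R ?f s))"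
      by (intro Bochner_Integration.integral_cong refl) (auto simp: indicator_def)
    also have "\<dots> = (LINT s|lebesgue. indicator {a..t} s *\<^sub>R ?f s)"
      by (rule integral_cong_AE[OF borel_measurable_scaleR[OF ind f_meas] f_meas AE])
    also have "\<dots> = u t - u a"
      using ftc(2) by (simp add: set_lebesgue_integral_def)
    finally show ?thesis .
  next
    case False
    then show ?thesis
      unfolding caputo_derivative_def using rl_integral_complementary[OF _ _ ftc(1)] ftc(2) \<alpha> by simp
  qed
qed

text \<open>Hoelder's inequality with the kernel in the conjugate exponent
  \<open>q = p / (p - 1)\<close>. The condition \<open>1 / p < \<alpha>\<close> is exactly what
  makes the \<open>q\<close>-th power of the kernel integrable.\<close>

lemma norm_rl_integral_le_Lp_norm:
  fixes f :: "real \<Rightarrow> 'a::euclidean_space"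
  assumes "1 < p" and \<alpha>: "1 / p < \<alpha>" and t: "t \<in> {a<..<b}" and f: "f \<in> Lp_space p (lebesgue_on {a<..<b})"
  shows "norm (rl_integral a \<alpha> f t) \<le> (t - a) powr (\<alpha> - 1 / p)
    / ((\<alpha> * p / (p - 1) - 1 / (p - 1)) powr ((p - 1) / p) * Gamma \<alpha>)
    * Lp_norm p (lebesgue_on {a<..<b}) f"
proof -
  define q where "q = p / (p - 1)"
  have q: "1 < q" "1 / q + 1 / p = 1" "1 / q = (p - 1) / p"
    using \<open>1 < p\<close> by (auto simp: q_def field_simps)
  \<comment> \<open>The \<open>q\<close>-th power of the kernel has exponent
    \<open>\<gamma> - 1\<close>, so its integral over the interval from \<open>a\<close> to
    \<open>t\<close> is \<open>(t - a) powr \<gamma> / \<gamma>\<close>. The base in the denominator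
    of the final constant is \<open>\<gamma>\<close>, and \<open>\<gamma> / q\<close> is the
    exponent of \<open>t - a\<close> there.\<close>
  define \<gamma> where "\<gamma> = (\<alpha> - 1) * q + 1"
  have \<gamma>_eq: "\<gamma> = (\<alpha> * p - 1) / (p - 1)"
    using \<open>1 < p\<close> by (simp add: \<gamma>_def q_def field_simps)
  then have \<gamma>: "\<gamma> = \<alpha> * p / (p - 1) - 1 / (p - 1)"
    by (simp add: diff_divide_distrib)
  have "0 < \<gamma>"
    using \<alpha> \<open>1 < p\<close> by (simp add: \<gamma>_eq field_simps)
  have "\<gamma> / q = \<alpha> - 1 + 1 / q"
    using q(1) by (simp add: \<gamma>_def add_divide_distrib)
  then have \<gamma>_div: "\<gamma> / q = \<alpha> - 1 / p"
    using q(2) by simp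
  have "0 < \<alpha>"
    using \<alpha> \<open>1 < p\<close> by (meson less_trans zero_less_divide_1_iff zero_less_one)
  let ?M = "lebesgue_on {a<..<b}"
  have Ioo: "{a<..<b} \<inter> space lebesgue \<in> sets lebesgue"
    by simp
  \<comment> \<open>The cut at \<open>a\<close> is open so that the support lies inside the interval
    carrying the Lp norm; the closed interval in the definition of \<open>rl_integral\<close>
    differs from it by one point.\<close>
  define k where "k s = indicator {a<..t} s * (t - s) powr (\<alpha> - 1)" for s
  have k_nonneg: "0 \<le> k s" for s
    by (simp add: k_def)
  have k_meas: "k \<in> borel_measurable ?M"
    unfolding k_def by (intro measurable_restrict_space1 measurable_completion) measurable
  have kq: "indicator {a<..<b} s *\<^sub>R k s powr q = indicator {a<..t} s *\<^sub>R (t - s) powr (\<gamma> - 1)" for s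
    using t by (auto simp: k_def indicator_def powr_powr \<gamma>_def)
  have "-1 < \<gamma> - 1"
    using \<open>0 < \<gamma>\<close> by simp
  note powr = set_integral_powr_reflected[of a t "\<gamma> - 1", OF _ this]
  have AE: "AE s in lebesgue. indicator {a<..t} s *\<^sub>R (t - s) powr (\<gamma> - 1)
      = indicator {a..t} s *\<^sub>R (t - s) powr (\<gamma> - 1)"
    using AE_completion[OF AE_lborel_singleton[of a]] by eventually_elim (auto simp: indicator_def)
  have meas: "(\<lambda>s. indicator {a<..t} s *\<^sub>R (t - s) powr (\<gamma> - 1)) \<in> borel_measurable lebesgue"
    "(\<lambda>s. indicator {a..t} s *\<^sub>R (t - s) powr (\<gamma> - 1)) \<in> borel_measurable lebesgue"
    by (intro measurable_completion; measurable)+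
  have k_int: "integrable ?M (\<lambda>s. k s powr q)"
    unfolding integrable_restrict_space[OF Ioo] kq integrable_cong_AE[OF meas AE]
    using powr(1) t by (simp add: set_integrable_def)
  have k_val: "(LINT s|?M. k s powr q) = (t - a) powr \<gamma> / \<gamma>"
    unfolding integral_restrict_space[OF Ioo] kq integral_cong_AE[OF meas AE]
    using powr(2) t by (simp add: set_lebesgue_integral_def)
  have f_meas: "f \<in> borel_measurable ?M" and f_int: "integrable ?M (\<lambda>s. norm (f s) powr p)"
    using f by (auto simp: Lp_space_def)
  have "norm (rl_integral a \<alpha> f t)
      = 1 / Gamma \<alpha> * norm (LINT s|lebesgue. indicator {a..t} s *\<^sub>R (t - s) powr (\<alpha> - 1) *\<^sub>R f s)"
    using \<open>0 < \<alpha>\<close> by (simp add: rl_integral_def set_lebesgue_integral_def)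
  also have "(LINT s|lebesgue. indicator {a..t} s *\<^sub>R (t - s) powr (\<alpha> - 1) *\<^sub>R f s)
      = (LINT s|?M. k s *\<^sub>R f s)"
  proof -
    \<comment> \<open>Measurability of \<open>f\<close> is given only on the open interval, so
      \<open>f\<close> is first extended by 0; the product with \<open>k\<close> is
      unaffected.\<close>
    have fm: "(\<lambda>s. indicator {a<..<b} s *\<^sub>R f s) \<in> borel_measurable lebesgue"
      using f_meas borel_measurable_restrict_space_iff[OF Ioo] by blast
    have km: "k \<in> borel_measurable lebesgue"
      unfolding k_def by (rule measurable_completion) measurable
    have m: "(\<lambda>s. k s *\<^sub>R (indicator {a<..<b} s *\<^sub>R f s)) \<in> borel_measurable lebesgue"
      by (rule borel_measurable_scaleR[OF km fm])
    have m_eq: "k s *\<^sub>R (indicator {a<..<b} s *\<^sub>R f s) = indicator {a<..t} s *\<^sub>R (t - s) powr (\<alpha> - 1) *\<^sub>R f s" for s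
      using t by (auto simp: k_def indicator_def)
    have ae: "AE s in lebesgue. indicator {a<..t} s *\<^sub>R (t - s) powr (\<alpha> - 1) *\<^sub>R f s
        = indicator {a..t} s *\<^sub>R (t - s) powr (\<alpha> - 1) *\<^sub>R f s"
      using AE_completion[OF AE_lborel_singleton[of a]] by eventually_elim (auto simp: indicator_def)
    have m1: "(\<lambda>s. indicator {a<..t} s *\<^sub>R (t - s) powr (\<alpha> - 1) *\<^sub>R f s) \<in> borel_measurable lebesgue"
      using m unfolding m_eq .
    have m2: "(\<lambda>s. indicator {a..t} s *\<^sub>R (t - s) powr (\<alpha> - 1) *\<^sub>R f s) \<in> borel_measurable lebesgue"
      by (rule borel_measurable_AE[OF m1 ae])
    have restrict: "indicator {a<..<b} s *\<^sub>R k s *\<^sub>R f s = indicator {a<..t} s *\<^sub>R (t - s) powr (\<alpha> - 1) *\<^sub>R f s" for s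
      using m_eq[of s] by (simp add: mult.commute)
    show ?thesis
      unfolding integral_restrict_space[OF Ioo] restrict by (rule integral_cong_AE[OF m1 m2 ae, symmetric])
  qed
  finally have rl_eq: "norm (rl_integral a \<alpha> f t) = 1 / Gamma \<alpha> * norm (LINT s|?M. k s *\<^sub>R f s)" .
  have "norm (LINT s|?M. k s *\<^sub>R f s) \<le> (LINT s|?M. norm (k s *\<^sub>R f s))"
    by (rule integral_norm_bound)
  also have "(LINT s|?M. norm (k s *\<^sub>R f s)) = (LINT s|?M. k s * norm (f s))"
    by (simp add: k_def)
  also have "\<dots> \<le> (LINT s|?M. k s powr q) powr (1 / q) * (LINT s|?M. norm (f s) powr p) powr (1 / p)"
    using \<open>1 < p\<close> q k_meas f_meas k_int f_int by (intro Holder_inequality) (auto simp: k_nonneg)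
  also have "(LINT s|?M. k s powr q) powr (1 / q) = (t - a) powr (\<alpha> - 1 / p) / \<gamma> powr (1 / q)"
    using t \<open>0 < \<gamma>\<close> by (simp add: k_val powr_divide powr_powr \<gamma>_div)
  finally have "norm (rl_integral a \<alpha> f t) \<le> 1 / Gamma \<alpha> *
      ((t - a) powr (\<alpha> - 1 / p) / \<gamma> powr (1 / q) * (LINT s|?M. norm (f s) powr p) powr (1 / p))"
    unfolding rl_eq using \<open>0 < \<alpha>\<close> by (intro mult_left_mono) auto
  then show ?thesis
    by (simp add: Lp_norm_def q(3) \<gamma> mult_ac)
qed

section \<open>The essential supremum bound through the Caputo derivative\<close>

theorem theorem3p2:
  fixes a b p \<alpha> :: real
    and u :: "real \<Rightarrow> 'a::{real_normed_field, euclidean_space}"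
  assumes "a < b"
    and "p > 1"
    and "\<alpha> \<in> {1 / p<..1}"
    and "absolutely_continuous_on_interval a b u"
    and "u \<in> Lp_space p (lebesgue_on {a<..<b})"
    and "u a = 0"
    and "caputo_derivative a \<alpha> u \<in> Lp_space p (lebesgue_on {a<..<b})"
  shows "Linf_norm (lebesgue_on {a<..<b}) u \<le>
    ereal ((b - a) powr (\<alpha> - 1 / p)
           / ((\<alpha> * p / (p - 1) - 1 / (p - 1)) powr ((p - 1) / p) * Gamma \<alpha>)
           * Lp_norm p (lebesgue_on {a<..<b}) (caputo_derivative a \<alpha> u))"
proof -
  let ?D = "caputo_derivative a \<alpha> u"
  let ?c = "(\<alpha> * p / (p - 1) - 1 / (p - 1)) powr ((p - 1) / p) * Gamma \<alpha>"
  have \<alpha>: "1 / p < \<alpha>" "\<alpha> \<le> 1"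
    using assms(3) by auto
  moreover have "0 < 1 / p"
    using \<open>p > 1\<close> by simp
  ultimately have "0 < \<alpha>"
    by linarith
  have bound: "norm (u t) \<le> (b - a) powr (\<alpha> - 1 / p) / ?c * Lp_norm p (lebesgue_on {a<..<b}) ?D"
    if t: "t \<in> {a<..<b}" for t
  proof -
    have "norm (u t) = norm (rl_integral a \<alpha> ?D t)"
      using rl_integral_caputo_derivative[OF assms(4) \<open>0 < \<alpha>\<close> \<alpha>(2), of t] t \<open>u a = 0\<close> by simp
    also have "\<dots> \<le> (t - a) powr (\<alpha> - 1 / p) / ?c * Lp_norm p (lebesgue_on {a<..<b}) ?D"
      using norm_rl_integral_le_Lp_norm[OF \<open>p > 1\<close> \<alpha>(1) t assms(7)] .
    \<comment> \<open>The exponent \<open>\<alpha> - 1 / p\<close> is positive, so enlarging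
      \<open>t - a\<close> to \<open>b - a\<close> makes the bound independent of
      \<open>t\<close>.\<close>
    also have "\<dots> \<le> (b - a) powr (\<alpha> - 1 / p) / ?c * Lp_norm p (lebesgue_on {a<..<b}) ?D"
      using t \<alpha> \<open>0 < \<alpha>\<close>
      by (intro mult_right_mono divide_right_mono powr_mono2) (auto simp: Lp_norm_def)
    finally show ?thesis .
  qed
  have "u \<in> borel_measurable (lebesgue_on {a<..<b})"
    using assms(5) by (simp add: Lp_space_def)
  then show ?thesis
    unfolding Linf_norm_def using bound by (intro esssup_I AE_I2) auto
qed

end
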